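(* Let $\Gamma$ be a weighted quiver without 1-cycles (no arrow joins a node to itself). Then the cluster seed $\Pi_\Gamma$ in the lattice $\Lambda_{|\Gamma|}$ admits a cluster Donaldson–Thomas transformation, i.e. there is a finite sequence $\boldsymbol\mu$ of (sign-coherent) mutations starting from $\Pi_\Gamma$ such that $\boldsymbol\mu(\Pi_\Gamma)=-\Pi_\Gamma$ as (unordered) subsets of $\Lambda_{|\Gamma|}$.
   Context: **Quiver data.** A weighted quiver $\Gamma$ is a finite quiver with nodes $\Gamma_0=\Gamma_0^{\mathrm g}\sqcup\Gamma_0^{\mathrm f}$ (gauge and flavor nodes) and arrows $\Gamma_1$, such that every flavor node has valency 1 and no arrow joins two flavor nodes. $\Gamma_1^{\mathrm g}$, $\Gamma_1^{\mathrm f_+}$, $\Gamma_1^{\mathrm f_-}$ denote the arrows between gauge nodes, the arrows whose source is a flavor node, and the arrows whose target is a flavor node. Each gauge node $i$ carries a complex vector space of finite dimension $d_i\ge1$, each flavor node a 1-dimensional space. Fix integer 1-cochains $\theta_1,\dots,\theta_g$ on $\Gamma$ whose classes form a basis of $H^1(\Gamma,\mathbb Z)$ and which vanish on arrows touching a flavor node. **Lattice and seed.** $\Lambda_{|\Gamma|}$ is the free abelian group with basis $p_{i,m},x_{i,m}$ ($i\in\Gamma_0^{\mathrm g}$, $1\le m\le d_i$), $\zeta_k$ ($k\in\Gamma_0^{\mathrm f}$), $\upsilon_r$ ($1\le r\le g$), with skew form $(p_{i,m},x_{j,n})=\delta_{ij}\delta_{mn}=-(x_{j,n},p_{i,m})$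 and all other pairings of basis vectors zero. Put $\upsilon(a)=\sum_r\theta_r(a)\upsilon_r$. The seed $\Pi_\Gamma$ consists of: for each $i\in\Gamma_0^{\mathrm g}$, $1\le m<d_i$, the vectors $e_{s_{i,m}}=x_{i,m+1}-x_{i,m}$ and $e_{t_{i,m}}=p_{i,m}-p_{i,m+1}+x_{i,m}-x_{i,m+1}$; and for each arrow $a\colon i\to j$ the vector $e_a=p_{j,d_j}-p_{i,1}+\upsilon(a)$ if $a\in\Gamma_1^{\mathrm g}$, $e_a=p_{j,d_j}-\zeta_i$ if $a\in\Gamma_1^{\mathrm f_+}$, $e_a=\zeta_j-p_{i,1}$ if $a\in\Gamma_1^{\mathrm f_-}$. **Mutations.** A cluster seed in a lattice $\Lambda$ with skew-symmetric integer form is a finite subset $\Pi$ extendable to a $\mathbb Z$-basis of $\Lambda$. For $e_k\in\Pi$ and $\varepsilon=\pm1$ the signed mutation $\mu^\varepsilon_k(\Pi)$ is the set of vectors $\mu_k^\varepsilon(e_k)=-e_k$, $\mu^\varepsilon_k(e_i)=e_i+\max\{0,\varepsilon(e_i,e_k)\}e_k$ for $i\ne k$. Given an initial seed $\Pi_0$ and a sequence of directions $(k_1,\dots,k_m)$ (labels persist under mutation), there are unique signs $\varepsilon_j$ such that, with $\Pi_j=\mu_{k_j}^{\varepsilon_j}(\Pi_{j-1})=\{e^{(j)}_\ell\}$, one has $\varepsilon_je^{(j)}_{k_j}\in\bigoplus_{e\in\Pi_0}\mathbb Z_{\le0}e$ for all $j$ (i.e. $\varepsilon_j=+1$ if $e^{(j-1)}_{k_j}$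 is a nonnegative combination of $\Pi_0$ and $-1$ if it is a nonpositive one). The sequence of mutations $\boldsymbol\mu$ in directions $(k_1,\dots,k_m)$ is performed with these signs, and $\boldsymbol\mu(\Pi_0)=\Pi_m$. *)

theory Defs
  imports "Graph_Theory.Digraph" "HOL-Library.Poly_Mapping"
begin

section \<open>Lattices, cluster seeds and mutations\<close>

text \<open>
  A free abelian group is rendered as a subgroup of \<open>'b \<Rightarrow>\<^sub>0 int\<close>; the library's module
  notions \<open>span\<close> and \<open>dependent\<close> are used for the scalar action \<open>frag_cmul\<close> of the integers.
\<close>

lemma module_frag_cmul: "module frag_cmul"
  by unfold_locales (simp_all add: frag_cmul_distrib frag_cmul_distrib2)

definition Z_basis :: "('b \<Rightarrow>\<^sub>0 int) set \<Rightarrow> ('b \<Rightarrow>\<^sub>0 int) set \<Rightarrow> bool" where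
  "Z_basis L B \<longleftrightarrow> \<not> module.dependent frag_cmul B \<and> module.span frag_cmul B = L"

text \<open>
  Seeds are labelled: the seed is the set \<open>e ` K\<close>, with \<open>e\<close> injective on the label set \<open>K\<close>,
  since the directions of a mutation sequence refer to labels that persist.
\<close>

definition cluster_seed ::
  "('b \<Rightarrow>\<^sub>0 int) set \<Rightarrow> 'k set \<Rightarrow> ('k \<Rightarrow> 'b \<Rightarrow>\<^sub>0 int) \<Rightarrow> bool" where
  "cluster_seed L K e \<longleftrightarrow>
     finite K \<and> inj_on e K \<and> (\<exists>B. Z_basis L B \<and> e ` K \<subseteq> B)"

text \<open>In the following, \<open>\<omega>\<close> is the skew form of the lattice.\<close>

definition mutation ::
  "(('b \<Rightarrow>\<^sub>0 int) \<Rightarrow> ('b \<Rightarrow>\<^sub>0 int) \<Rightarrow> int) \<Rightarrow> int \<Rightarrow> 'k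
     \<Rightarrow> ('k \<Rightarrow> 'b \<Rightarrow>\<^sub>0 int) \<Rightarrow> ('k \<Rightarrow> 'b \<Rightarrow>\<^sub>0 int)" where
  "mutation \<omega> \<epsilon> k e =
     (\<lambda>i. if i = k then - e k else e i + frag_cmul (max 0 (\<epsilon> * \<omega> (e i) (e k))) (e k))"

definition nonpos_cone :: "'k set \<Rightarrow> ('k \<Rightarrow> 'b \<Rightarrow>\<^sub>0 int) \<Rightarrow> ('b \<Rightarrow>\<^sub>0 int) set" where
  "nonpos_cone K e = {\<Sum>l\<in>K. frag_cmul (c l) (e l) | c. \<forall>l\<in>K. c l \<le> 0}"

text \<open>
  \<open>coherent_mutations \<omega> K e\<^sub>0 ks e\<close>: performing the mutations in directions \<open>ks\<close> on the seed
  \<open>e\<^sub>0\<close>, each with its coherent sign, yields \<open>e\<close>. As the vectors of \<open>e\<^sub>0\<close> are linearly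
  independent for a cluster seed, at most one sign satisfies the condition at each step.
\<close>

inductive coherent_mutations ::
  "(('b \<Rightarrow>\<^sub>0 int) \<Rightarrow> ('b \<Rightarrow>\<^sub>0 int) \<Rightarrow> int) \<Rightarrow> 'k set \<Rightarrow> ('k \<Rightarrow> 'b \<Rightarrow>\<^sub>0 int)
     \<Rightarrow> 'k list \<Rightarrow> ('k \<Rightarrow> 'b \<Rightarrow>\<^sub>0 int) \<Rightarrow> bool"
  for \<omega> K e\<^sub>0 where
  start: "coherent_mutations \<omega> K e\<^sub>0 [] e\<^sub>0"
| step: "\<lbrakk> coherent_mutations \<omega> K e\<^sub>0 ks e; k \<in> K; \<epsilon> = 1 \<or> \<epsilon> = - 1;
           frag_cmul \<epsilon> (mutation \<omega> \<epsilon> k e k) \<in> nonpos_cone K e\<^sub>0 \<rbrakk>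
         \<Longrightarrow> coherent_mutations \<omega> K e\<^sub>0 (ks @ [k]) (mutation \<omega> \<epsilon> k e)"

definition admits_cluster_DT ::
  "(('b \<Rightarrow>\<^sub>0 int) \<Rightarrow> ('b \<Rightarrow>\<^sub>0 int) \<Rightarrow> int) \<Rightarrow> 'k set \<Rightarrow> ('k \<Rightarrow> 'b \<Rightarrow>\<^sub>0 int) \<Rightarrow> bool" where
  "admits_cluster_DT \<omega> K e\<^sub>0 \<longleftrightarrow>
     (\<exists>ks e. coherent_mutations \<omega> K e\<^sub>0 ks e \<and> e ` K = uminus ` (e\<^sub>0 ` K))"

section \<open>Weighted quivers\<close>

text \<open>\<open>F\<close> is the set of flavor nodes; the gauge nodes are \<open>verts \<Gamma> - F\<close>.\<close>

locale weighted_quiver = fin_digraph \<Gamma> for \<Gamma> :: "('v, 'a) pre_digraph" +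
  fixes F :: "'v set" and d :: "'v \<Rightarrow> nat"
  assumes flavor_subset: "F \<subseteq> verts \<Gamma>"
    and flavor_valency: "v \<in> F \<Longrightarrow> in_degree \<Gamma> v + out_degree \<Gamma> v = 1"
    and no_flavor_flavor: "a \<in> arcs \<Gamma> \<Longrightarrow> \<not> (tail \<Gamma> a \<in> F \<and> head \<Gamma> a \<in> F)"
    and gauge_dim: "v \<in> verts \<Gamma> - F \<Longrightarrow> d v \<ge> 1"
    and flavor_dim: "v \<in> F \<Longrightarrow> d v = 1"

text \<open>
  Integer 1-cochains are functions on arrows. The first cohomology group of \<open>\<Gamma>\<close> is the quotient
  of the 1-cochains by the coboundaries of 0-cochains \<open>f\<close>.
\<close>

definition cohomologous ::
  "('v, 'a) pre_digraph \<Rightarrow> ('a \<Rightarrow> int) \<Rightarrow> ('a \<Rightarrow> int) \<Rightarrow> bool" where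
  "cohomologous \<Gamma> c c' \<longleftrightarrow>
     (\<exists>f :: 'v \<Rightarrow> int. \<forall>a\<in>arcs \<Gamma>. c a - c' a = f (head \<Gamma> a) - f (tail \<Gamma> a))"

definition H1_basis :: "('v, 'a) pre_digraph \<Rightarrow> nat \<Rightarrow> (nat \<Rightarrow> 'a \<Rightarrow> int) \<Rightarrow> bool" where
  "H1_basis \<Gamma> g \<theta> \<longleftrightarrow>
     (\<forall>c. \<exists>n. cohomologous \<Gamma> c (\<lambda>a. \<Sum>r=1..g. n r * \<theta> r a)) \<and>
     (\<forall>n. cohomologous \<Gamma> (\<lambda>a. \<Sum>r=1..g. n r * \<theta> r a) (\<lambda>a. 0) \<longrightarrow> (\<forall>r\<in>{1..g}. n r = 0))"

section \<open>The lattice and the seed of a weighted quiver\<close>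

datatype 'v gen = P 'v nat | X 'v nat | Zeta 'v | Upsilon nat

definition gens :: "('v, 'a) pre_digraph \<Rightarrow> 'v set \<Rightarrow> ('v \<Rightarrow> nat) \<Rightarrow> nat \<Rightarrow> 'v gen set" where
  "gens \<Gamma> F d g =
     {P i m | i m. i \<in> verts \<Gamma> - F \<and> m \<in> {1..d i}} \<union>
     {X i m | i m. i \<in> verts \<Gamma> - F \<and> m \<in> {1..d i}} \<union>
     Zeta ` F \<union> Upsilon ` {1..g}"

definition quiver_lattice ::
  "('v, 'a) pre_digraph \<Rightarrow> 'v set \<Rightarrow> ('v \<Rightarrow> nat) \<Rightarrow> nat \<Rightarrow> ('v gen \<Rightarrow>\<^sub>0 int) set" where
  "quiver_lattice \<Gamma> F d g = {u. Poly_Mapping.keys u \<subseteq> gens \<Gamma> F d g}"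

definition quiver_form ::
  "('v, 'a) pre_digraph \<Rightarrow> 'v set \<Rightarrow> ('v \<Rightarrow> nat)
     \<Rightarrow> ('v gen \<Rightarrow>\<^sub>0 int) \<Rightarrow> ('v gen \<Rightarrow>\<^sub>0 int) \<Rightarrow> int" where
  "quiver_form \<Gamma> F d u w =
     (\<Sum>i\<in>verts \<Gamma> - F. \<Sum>m=1..d i.
        Poly_Mapping.lookup u (P i m) * Poly_Mapping.lookup w (X i m) -
        Poly_Mapping.lookup u (X i m) * Poly_Mapping.lookup w (P i m))"

datatype ('v, 'a) label = S 'v nat | T 'v nat | Arrow 'a

definition seed_labels ::
  "('v, 'a) pre_digraph \<Rightarrow> 'v set \<Rightarrow> ('v \<Rightarrow> nat) \<Rightarrow> ('v, 'a) label set" where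
  "seed_labels \<Gamma> F d =
     {S i m | i m. i \<in> verts \<Gamma> - F \<and> 1 \<le> m \<and> m < d i} \<union>
     {T i m | i m. i \<in> verts \<Gamma> - F \<and> 1 \<le> m \<and> m < d i} \<union>
     Arrow ` arcs \<Gamma>"

fun seed_vector ::
  "('v, 'a) pre_digraph \<Rightarrow> 'v set \<Rightarrow> ('v \<Rightarrow> nat) \<Rightarrow> nat \<Rightarrow> (nat \<Rightarrow> 'a \<Rightarrow> int)
     \<Rightarrow> ('v, 'a) label \<Rightarrow> ('v gen \<Rightarrow>\<^sub>0 int)" where
  "seed_vector \<Gamma> F d g \<theta> (S i m) = frag_of (X i (m + 1)) - frag_of (X i m)"
| "seed_vector \<Gamma> F d g \<theta> (T i m) =
     frag_of (P i m) - frag_of (P i (m + 1)) + frag_of (X i m) - frag_of (X i (m + 1))"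
| "seed_vector \<Gamma> F d g \<theta> (Arrow a) =
     (let i = tail \<Gamma> a; j = head \<Gamma> a in
      if i \<in> F then frag_of (P j (d j)) - frag_of (Zeta i)
      else if j \<in> F then frag_of (Zeta j) - frag_of (P i 1)
      else frag_of (P j (d j)) - frag_of (P i 1)
             + (\<Sum>r=1..g. frag_cmul (\<theta> r a) (frag_of (Upsilon r))))"

end

theory Submission
  imports Defs "HOL-Library.Multiset"
begin

text \<open>
  The labels of a seed matter only through the vectors they carry, so a mutation sequence is a
  sequence of moves on a multiset of vectors. Every mutation below is performed at a vector
  \<open>u\<close> that is a nonnegative combination of the initial seed; its coherent sign is then
  \<open>+1\<close>, and the move replaces \<open>u\<close> by \<open>- u\<close> and adds \<open>u\<close>
  to the other vectors \<open>v\<close> with multiplicity \<open>max 0 (\<omega> v u)\<close>. It remains to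
  go from the seed to its negative by such moves. This is done in two stages.

  The first stage reverses every arrow: for \<open>a : i \<rightarrow> j\<close> the vector
  \<open>p\<^sub>j\<^sub>,\<^sub>d - p\<^sub>i\<^sub>,\<^sub>1 + \<upsilon>(a)\<close> is replaced by
  \<open>- (p\<^sub>j\<^sub>,\<^sub>1 - p\<^sub>i\<^sub>,\<^sub>d + \<upsilon>(a))\<close>, and nothing else
  changes. The vectors \<open>s\<close>, \<open>t\<close> at \<open>i\<close> and \<open>j\<close> together with
  that of \<open>a\<close> are the differences of consecutive entries of a list of weights: a chain
  from \<open>p\<^sub>i\<^sub>,\<^sub>d\<close> to \<open>p\<^sub>i\<^sub>,\<^sub>1\<close> at the tail followed by a
  chain from \<open>p\<^sub>j\<^sub>,\<^sub>d\<close> to \<open>p\<^sub>j\<^sub>,\<^sub>1\<close> at the head, with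
  one half-step weight between any two momenta. Mutating at the difference of two adjacent
  weights, one from each chain, exchanges these weights (\<open>reachable_swap\<close>), as for the
  simple roots of type A, provided the pairings of the remaining weights with that difference
  weakly decrease along the list on either side. The exchanges can be ordered so that this always
  holds (\<open>swap_form_below\<close>, \<open>swap_form_above\<close>), and after all of them the two chains have crossed
  (\<open>reachable_cross\<close>): they now meet at their other ends, and the difference there is
  the reversed arrow.
  A loop would put both chains at the same node and destroy the orthogonality used here.
  The other arrows pair nonpositively with every mutated vector (\<open>form_mom_ends\<close>) and
  are therefore left alone (\<open>reachable_reverse_arrow\<close>).

  The second stage treats one gauge node after the other. At a node of dimension \<open>d\<close> the
  vectors \<open>s\<close> and \<open>t\<close> form the seed of an open Toda chain, which is mutated
  \<open>d\<close> times at all of its currently positive vectors simultaneously. The vectors mutated in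
  round \<open>r\<close> solve a discrete wave equation with reflecting ends; its solution is a
  difference of two travelling copies of one profile, which makes positivity visible
  (\<open>effective_\<sigma>\<close>) and shows that after \<open>d\<close> rounds every \<open>s\<close> and
  \<open>t\<close> has been reflected and negated (\<open>\<sigma>_end\<close>, \<open>\<sigma>_before_end\<close>).
  Meanwhile each arrow at the node gains the sum of all \<open>s\<close> and \<open>t\<close>, which is
  \<open>p\<^sub>1 - p\<^sub>d\<close> (\<open>reachable_reverse_node\<close>). Applied at both ends this turns
  the reversed arrow into the negative of the original one.

  That the vectors extend to a basis of the lattice is seen from dual functionals on the lattice
  (\<open>cluster_seed_if_dual_functionals\<close>): for the arrows they are cochains
  \<open>\<Sum>\<^sub>r n\<^sub>r \<theta>\<^sub>r\<close> plus a coboundary, and every integer cochain has this form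
  because the \<open>\<theta>\<^sub>r\<close> span the first cohomology.
\<close>

section \<open>Mutation sequences as moves on multisets of vectors\<close>

lemma additive_frag_cmul:
  fixes \<phi> :: "('b \<Rightarrow>\<^sub>0 int) \<Rightarrow> int"
  assumes add: "\<And>u v. \<phi> (u + v) = \<phi> u + \<phi> v"
  shows "\<phi> (frag_cmul c u) = c * \<phi> u"
proof -
  have zero: "\<phi> 0 = 0" using add[of 0 0] by simp
  have neg: "\<phi> (- v) = - \<phi> v" for v using add[of v "- v"] zero by simp
  have nat: "\<phi> (frag_cmul (int n) u) = int n * \<phi> u" for n
    by (induction n) (simp_all add: frag_cmul_distrib add zero algebra_simps)
  show ?thesis
  proof (cases c rule: int_cases2)
    case (nonneg n)
    then show ?thesis using nat by simp
  next
    case (nonpos n)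
    show ?thesis unfolding nonpos module.scale_minus_left[OF module_frag_cmul] neg nat by simp
  qed
qed

lemma additive_sum:
  fixes \<phi> :: "('b \<Rightarrow>\<^sub>0 int) \<Rightarrow> int"
  assumes add: "\<And>u v. \<phi> (u + v) = \<phi> u + \<phi> v"
  shows "\<phi> (\<Sum>i\<in>I. f i) = (\<Sum>i\<in>I. \<phi> (f i))"
  using add[of 0 0] by (induction I rule: infinite_finite_induct) (simp_all add: add)

locale green_mutations =
  fixes \<omega> :: "('b \<Rightarrow>\<^sub>0 int) \<Rightarrow> ('b \<Rightarrow>\<^sub>0 int) \<Rightarrow> int"
    and K :: "'k set" and e\<^sub>0 :: "'k \<Rightarrow> 'b \<Rightarrow>\<^sub>0 int"
  assumes finite_labels: "finite K"
    and form_add_left: "\<omega> (u + v) w = \<omega> u w + \<omega> v w"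
    and form_skew: "\<omega> u v = - \<omega> v u"
begin

lemma form_add_right: "\<omega> w (u + v) = \<omega> w u + \<omega> w v"
  using form_add_left form_skew by (metis minus_add_distrib)

lemma form_zero_left: "\<omega> 0 w = 0"
  using form_add_left[of 0 0 w] by simp

lemma form_zero_right: "\<omega> w 0 = 0"
  using form_add_right[of w 0 0] by simp

lemma form_uminus_left: "\<omega> (- u) w = - \<omega> u w"
  using form_add_left[of u "- u" w] by (simp add: form_zero_left)

lemma form_uminus_right: "\<omega> w (- u) = - \<omega> w u"
  using form_add_right[of w u "- u"] by (simp add: form_zero_right)

lemma form_diff_left: "\<omega> (u - v) w = \<omega> u w - \<omega> v w"
  using form_add_left[of u "- v" w] by (simp add: form_uminus_left)

lemma form_diff_right: "\<omega> w (u - v) = \<omega> w u - \<omega> w v"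
  using form_add_right[of w u "- v"] by (simp add: form_uminus_right)

lemma form_self: "\<omega> u u = 0"
  using form_skew[of u u] by simp

lemma form_sum_left: "\<omega> (\<Sum>i\<in>I. f i) w = (\<Sum>i\<in>I. \<omega> (f i) w)"
  by (rule additive_sum[where \<phi> = "\<lambda>u. \<omega> u w", OF form_add_left])

lemma form_cmul_left: "\<omega> (frag_cmul c u) w = c * \<omega> u w"
  by (rule additive_frag_cmul[where \<phi> = "\<lambda>u. \<omega> u w", OF form_add_left])

lemma form_cmul_right: "\<omega> w (frag_cmul c u) = c * \<omega> w u"
  using form_cmul_left form_skew by (metis mult_minus_right)

lemmas form_simps = form_cmul_left form_cmul_right form_add_left form_add_right form_zero_left form_zero_right
  form_uminus_left form_uminus_right form_diff_left form_diff_right form_self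

text \<open>
  If \<open>u\<close> is effective then \<open>+1\<close> is the coherent sign for a mutation at \<open>u\<close>.
\<close>
definition effective :: "('b \<Rightarrow>\<^sub>0 int) \<Rightarrow> bool" where
  "effective u \<longleftrightarrow> - u \<in> nonpos_cone K e\<^sub>0"

lemma effective_zero: "effective 0"
  unfolding effective_def nonpos_cone_def by (auto intro!: exI[of _ "\<lambda>_. 0"])

lemma effective_add:
  assumes "effective u" "effective v"
  shows "effective (u + v)"
proof -
  obtain b c where b: "- u = (\<Sum>l\<in>K. frag_cmul (b l) (e\<^sub>0 l))" "\<forall>l\<in>K. b l \<le> 0"
    and c: "- v = (\<Sum>l\<in>K. frag_cmul (c l) (e\<^sub>0 l))" "\<forall>l\<in>K. c l \<le> 0"
    using assms unfolding effective_def nonpos_cone_def by auto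
  have "- (u + v) = (\<Sum>l\<in>K. frag_cmul (b l + c l) (e\<^sub>0 l))"
    using b(1) c(1) by (simp add: frag_cmul_distrib sum.distrib minus_add_distrib)
  then show ?thesis
    unfolding effective_def nonpos_cone_def using b(2) c(2)
    by (intro CollectI exI[of _ "\<lambda>l. b l + c l"]) (auto intro: add_nonpos_nonpos)
qed

lemma effective_sum:
  "(\<And>i. i \<in> I \<Longrightarrow> effective (f i)) \<Longrightarrow> effective (\<Sum>i\<in>I. f i)"
  by (induction I rule: infinite_finite_induct) (simp_all add: effective_zero effective_add)

lemma effective_seed:
  assumes "k \<in> K"
  shows "effective (e\<^sub>0 k)"
proof -
  have "- e\<^sub>0 k = (\<Sum>l\<in>K. frag_cmul (if l = k then - 1 else 0) (e\<^sub>0 l))"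
    using finite_labels assms by (simp add: if_distrib[of "\<lambda>c. frag_cmul c _"] cong: if_cong)
  then show ?thesis
    unfolding effective_def nonpos_cone_def by (auto intro!: exI[of _ "\<lambda>l. if l = k then - 1 else 0"])
qed

definition reachable :: "('b \<Rightarrow>\<^sub>0 int) multiset \<Rightarrow> bool" where
  "reachable R \<longleftrightarrow>
     (\<exists>ks e. coherent_mutations \<omega> K e\<^sub>0 ks e \<and> image_mset e (mset_set K) = R)"

definition shear :: "('b \<Rightarrow>\<^sub>0 int) \<Rightarrow> ('b \<Rightarrow>\<^sub>0 int) \<Rightarrow> ('b \<Rightarrow>\<^sub>0 int)" where
  "shear u v = v + frag_cmul (max 0 (\<omega> v u)) u"

lemma shear_nonpos: "\<omega> v u \<le> 0 \<Longrightarrow> shear u v = v"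
  by (simp add: shear_def max_def)

lemma shear_one: "\<omega> v u = 1 \<Longrightarrow> shear u v = v + u"
  by (simp add: shear_def)

lemma reachable_start: "reachable (image_mset e\<^sub>0 (mset_set K))"
  unfolding reachable_def using coherent_mutations.start by blast

lemma reachable_mutate:
  assumes "reachable (add_mset u R)" "effective u"
  shows "reachable (add_mset (- u) (image_mset (shear u) R))"
proof -
  obtain ks e where e: "coherent_mutations \<omega> K e\<^sub>0 ks e"
      "image_mset e (mset_set K) = add_mset u R"
    using assms(1) unfolding reachable_def by blast
  have "u \<in># image_mset e (mset_set K)" by (simp add: e(2))
  then obtain k where k: "k \<in> K" "e k = u"
    using finite_labels by auto
  have K: "mset_set K = add_mset k (mset_set (K - {k}))"
    using mset_set.remove[OF finite_labels k(1)] by simp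
  have R: "image_mset e (mset_set (K - {k})) = R"
    using e(2) k(2) unfolding K by simp
  let ?e = "mutation \<omega> 1 k e"
  have "frag_cmul 1 (?e k) \<in> nonpos_cone K e\<^sub>0"
    using assms(2) k(2) by (simp add: mutation_def effective_def)
  then have "coherent_mutations \<omega> K e\<^sub>0 (ks @ [k]) ?e"
    using coherent_mutations.step[OF e(1) k(1), of 1] by simp
  moreover have "image_mset ?e (mset_set (K - {k})) = image_mset (shear u \<circ> e) (mset_set (K - {k}))"
    by (rule image_mset_cong) (use finite_labels k(2) in \<open>auto simp: mutation_def shear_def\<close>)
  then have "image_mset ?e (mset_set K) = add_mset (- u) (image_mset (shear u) R)"
    unfolding K R[symmetric] using k(2)
    by (simp add: mutation_def multiset.map_comp)
  ultimately show ?thesis unfolding reachable_def by blast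
qed

lemma reachable_imp_admits_cluster_DT:
  assumes "reachable (image_mset (\<lambda>k. - e\<^sub>0 k) (mset_set K))"
  shows "admits_cluster_DT \<omega> K e\<^sub>0"
proof -
  obtain ks e where e: "coherent_mutations \<omega> K e\<^sub>0 ks e"
      "image_mset e (mset_set K) = image_mset (\<lambda>k. - e\<^sub>0 k) (mset_set K)"
    using assms unfolding reachable_def by blast
  have "e ` K = uminus ` (e\<^sub>0 ` K)"
    using arg_cong[OF e(2), of set_mset] finite_labels by (simp add: image_image)
  then show ?thesis using e(1) unfolding admits_cluster_DT_def by blast
qed

text \<open>
  Mutually orthogonal vectors do not see each other's mutations, so a whole family can be mutated
  at once, and the order is irrelevant.
\<close>
lemma reachable_mutate_orthogonal:
  assumes "finite I"
    and "reachable (image_mset f (mset_set I) + R)"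
    and "\<And>i. i \<in> I \<Longrightarrow> effective (f i)"
    and "\<And>i j. i \<in> I \<Longrightarrow> j \<in> I \<Longrightarrow> \<omega> (f i) (f j) = 0"
  shows "reachable (image_mset (\<lambda>i. - f i) (mset_set I) +
           image_mset (\<lambda>v. v + (\<Sum>i\<in>I. frag_cmul (max 0 (\<omega> v (f i))) (f i))) R)"
  using assms
proof (induction I arbitrary: R rule: finite_induct)
  case empty
  then show ?case by simp
next
  case (insert x I)
  have orth: "\<omega> (f i) (f x) = 0" "\<omega> (f x) (f i) = 0" if "i \<in> I" for i
    using insert.prems(3) that by auto
  have "reachable (add_mset (f x) (image_mset f (mset_set I) + R))"
    using insert by simp
  from reachable_mutate[OF this] insert.prems(2)
  have "reachable (add_mset (- f x)
      (image_mset (shear (f x) \<circ> f) (mset_set I) + image_mset (shear (f x)) R))"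
    by (simp add: multiset.map_comp)
  moreover have "image_mset (shear (f x) \<circ> f) (mset_set I) = image_mset f (mset_set I)"
    by (rule image_mset_cong) (use insert.hyps orth in \<open>auto simp: shear_nonpos\<close>)
  ultimately have "reachable (image_mset f (mset_set I) +
      add_mset (- f x) (image_mset (shear (f x)) R))"
    by simp
  from insert.IH[OF this insert.prems(2,3)]
  have "reachable (image_mset (\<lambda>i. - f i) (mset_set I) +
     image_mset (\<lambda>v. v + (\<Sum>i\<in>I. frag_cmul (max 0 (\<omega> v (f i))) (f i)))
       (add_mset (- f x) (image_mset (shear (f x)) R)))"
    by blast
  moreover have "- f x + (\<Sum>i\<in>I. frag_cmul (max 0 (\<omega> (- f x) (f i))) (f i)) = - f x"
    by (simp add: sum.neutral form_uminus_left orth)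
  moreover have "shear (f x) v + (\<Sum>i\<in>I. frag_cmul (max 0 (\<omega> (shear (f x) v) (f i))) (f i))
      = v + (\<Sum>i\<in>insert x I. frag_cmul (max 0 (\<omega> v (f i))) (f i))" for v
  proof -
    have "\<omega> (shear (f x) v) (f i) = \<omega> v (f i)" if "i \<in> I" for i
      using orth[OF that] by (simp add: shear_def form_add_left form_cmul_left)
    then have "(\<Sum>i\<in>I. frag_cmul (max 0 (\<omega> (shear (f x) v) (f i))) (f i))
        = (\<Sum>i\<in>I. frag_cmul (max 0 (\<omega> v (f i))) (f i))"
      by (intro sum.cong) simp_all
    then show ?thesis
      using insert.hyps by (simp add: shear_def add.assoc)
  qed
  ultimately have "reachable (image_mset (\<lambda>i. - f i) (mset_set I) + add_mset (- f x)
     (image_mset (\<lambda>v. v + (\<Sum>i\<in>insert x I. frag_cmul (max 0 (\<omega> v (f i))) (f i))) R))"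
    by (simp only: image_mset_add_mset multiset.map_comp comp_def)
  then show ?case
    by (simp only: mset_set.insert[OF insert.hyps] image_mset_add_mset
        union_mset_add_mset_left union_mset_add_mset_right)
qed

end

section \<open>Seeds that are differences of consecutive weights\<close>

text \<open>
  For the weights of the standard representation of type A in some order, \<open>diffs\<close> is the
  set of simple roots of that order.
\<close>
fun diffs :: "'c :: ab_group_add list \<Rightarrow> 'c multiset" where
  "diffs (x # y # zs) = add_mset (y - x) (diffs (y # zs))"
| "diffs [x] = {#}"
| "diffs [] = {#}"

lemma diffs_append: "diffs (us @ x # vs) = diffs (us @ [x]) + diffs (x # vs)"
proof (induction us)
  case (Cons y us)
  then show ?case by (cases us) auto
qed simp

lemma diffs_snoc: "us \<noteq> [] \<Longrightarrow> diffs (us @ [x]) = add_mset (x - last us) (diffs us)"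
  using diffs_append[of "butlast us" "last us" "[x]"]
  by (metis add_mset_add_single append.assoc append_Cons append_Nil append_butlast_last_id
      diffs.simps(1,2))

lemma diffs_Cons: "vs \<noteq> [] \<Longrightarrow> diffs (x # vs) = add_mset (hd vs - x) (diffs vs)"
  by (cases vs) auto

context green_mutations
begin

lemma shear_diffs_decreasing:
  "sorted_wrt (\<lambda>x y. \<omega> x u \<ge> \<omega> y u) ws \<Longrightarrow> image_mset (shear u) (diffs ws) = diffs ws"
  by (induction ws rule: diffs.induct) (auto simp: shear_nonpos form_diff_left)

text \<open>
  Exchanging two adjacent weights \<open>x\<close>, \<open>y\<close> changes the differences exactly as the
  mutation at \<open>y - x\<close> does: the difference itself is negated and the two neighbouring ones
  grow by \<open>y - x\<close>. Differences further away must not grow, that is, they must pair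
  nonpositively with \<open>y - x\<close>, which says that the pairing with \<open>y - x\<close> weakly
  decreases along the list.
\<close>
lemma reachable_swap:
  assumes reach: "reachable (R + diffs (us @ x # y # vs))"
    and eff: "effective (y - x)"
    and rest: "\<And>r. r \<in># R \<Longrightarrow> \<omega> r (y - x) \<le> 0"
    and xy: "\<omega> x y = 0"
    and us: "sorted_wrt (\<lambda>a b. \<omega> a (y - x) \<ge> \<omega> b (y - x)) us"
      "us \<noteq> [] \<Longrightarrow> \<omega> (last us) (y - x) = - 1"
    and vs: "sorted_wrt (\<lambda>a b. \<omega> a (y - x) \<ge> \<omega> b (y - x)) vs"
      "vs \<noteq> [] \<Longrightarrow> \<omega> (hd vs) (y - x) = 1"
  shows "reachable (R + diffs (us @ y # x # vs))"
proof -
  have xu: "\<omega> x (y - x) = 0" and yu: "\<omega> y (y - x) = 0"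
    using xy form_skew[of y x] by (simp_all only: form_diff_right form_self)
  have "reachable (add_mset (y - x) (R + diffs (us @ [x]) + diffs (y # vs)))"
    using reach by (simp add: diffs_append[of us x "y # vs"] ac_simps)
  from reachable_mutate[OF this eff]
  have "reachable (add_mset (x - y) (image_mset (shear (y - x)) R
      + image_mset (shear (y - x)) (diffs (us @ [x]))
      + image_mset (shear (y - x)) (diffs (y # vs))))"
    by simp
  moreover have "image_mset (shear (y - x)) R = R"
    using rest by (simp add: shear_nonpos cong: image_mset_cong)
  moreover have "image_mset (shear (y - x)) (diffs (us @ [x])) = diffs (us @ [y])"
  proof (cases "us = []")
    case False
    have "shear (y - x) (x - last us) = y - last us"
      using us(2)[OF False] xu by (simp add: shear_one form_diff_left)
    then show ?thesis
      using False by (simp add: diffs_snoc shear_diffs_decreasing[OF us(1)])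
  qed simp
  moreover have "image_mset (shear (y - x)) (diffs (y # vs)) = diffs (x # vs)"
  proof (cases "vs = []")
    case False
    have "shear (y - x) (hd vs - y) = hd vs - x"
      using vs(2)[OF False] yu by (simp add: shear_one form_diff_left)
    then show ?thesis
      using False by (simp add: diffs_Cons shear_diffs_decreasing[OF vs(1)])
  qed simp
  ultimately have "reachable (add_mset (x - y) (R + diffs (us @ [y]) + diffs (x # vs)))"
    by simp
  then show ?thesis by (simp add: diffs_append[of us y "x # vs"] ac_simps)
qed

end

section \<open>The order of the exchanges between two chains\<close>

text \<open>
  The weights of the two chains are named by letters. The initial word is
  \<open>Left n \<dots> Left 0 Right 0 \<dots> Right m\<close>, the final one
  \<open>Right 0 \<dots> Right m Left n \<dots> Left 0\<close>; each pair \<open>Left l\<close>, \<open>Right k\<close>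
  is exchanged once, in round \<open>k + l\<close>.
\<close>
datatype letter = Right nat | Left nat

text \<open>
  The word is determined by a height on the letters. In round \<open>r\<close> the letters \<open>Right i\<close>
  and \<open>Left (r - i)\<close> stand next to each other at the heights \<open>2 * i\<close> and
  \<open>2 * i + 1\<close>; the set \<open>Z\<close> records the \<open>i\<close> for which they have already been
  exchanged. Rounds and heights make sense for all indices, so the end of a chain needs no special
  treatment: a missing letter merely leaves a gap.
\<close>
fun height :: "nat \<Rightarrow> nat set \<Rightarrow> letter \<Rightarrow> int" where
  "height r Z (Right k) = 2 * int k + (if k \<in> Z then 0 else 1)"
| "height r Z (Left l) = 2 * (int r - int l) + (if l \<le> r \<and> r - l \<in> Z then 1 else 0)"

text \<open>
  The pairing of two weights of the same chain. Neighbours pair to \<open>1\<close> in absolute value.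
  Even positions carry momenta, which are orthogonal to each other, whereas the half-steps at odd
  positions also pair with the next half-step.
\<close>
definition chain_form :: "nat \<Rightarrow> nat \<Rightarrow> int" where
  "chain_form k k' =
     (if k = k' + 1 \<or> k = k' + 2 \<and> odd k' then 1
      else if k' = k + 1 \<or> k' = k + 2 \<and> odd k then - 1 else 0)"

text \<open>
  The pairing of a letter with the difference of \<open>Right k\<close> and \<open>Left l\<close>.
\<close>
fun swap_form :: "nat \<Rightarrow> nat \<Rightarrow> letter \<Rightarrow> int" where
  "swap_form k l (Right k') = chain_form k' k"
| "swap_form k l (Left l') = - chain_form l' l"

definition letters :: "nat \<Rightarrow> nat \<Rightarrow> letter set" where
  "letters m n = Right ` {..m} \<union> Left ` {..n}"

text \<open>
  In even rounds the exchanges are independent of each other. In odd rounds one of the two letters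
  is a half-step, whose pairing reaches over two positions; the letters at distance two have to be
  in the right order, which forces odd \<open>i\<close> to be treated in decreasing order and, after them,
  even \<open>i\<close> in increasing order.
\<close>
definition swappable :: "nat \<Rightarrow> nat set \<Rightarrow> nat \<Rightarrow> bool" where
  "swappable r Z i \<longleftrightarrow> i \<le> r \<and> i \<notin> Z \<and>
    (odd r \<and> odd i \<longrightarrow> (2 \<le> i \<longrightarrow> i - 2 \<notin> Z) \<and> (i + 2 \<le> r \<longrightarrow> i + 2 \<in> Z)) \<and>
    (odd r \<and> even i \<longrightarrow> (2 \<le> i \<longrightarrow> i - 2 \<in> Z) \<and> (i + 2 \<le> r \<longrightarrow> i + 2 \<notin> Z))"

fun pair_index :: "nat \<Rightarrow> letter \<Rightarrow> int" where
  "pair_index r (Right k) = int k"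
| "pair_index r (Left l) = int r - int l"

lemma height_div_2: "height r Z a div 2 = pair_index r a"
  by (cases a) auto

lemma height_mono: "height r Z a \<le> height r Z b \<Longrightarrow> pair_index r a \<le> pair_index r b"
  using zdiv_mono1[of "height r Z a" "height r Z b" 2] by (simp add: height_div_2)

lemma height_inj:
  assumes "height r Z a = height r Z b"
  shows "a = b"
proof -
  have i: "pair_index r a = pair_index r b"
    using assms height_div_2 by metis
  have False if "a = Right k" "b = Left l" "height r Z a = height r Z b" "pair_index r a = pair_index r b"
    for a b k l
  proof -
    have "l \<le> r" "r - l = k" using that by auto
    then show False using that by (auto split: if_splits)
  qed
  then show ?thesis using i assms by (cases a; cases b) (auto, metis+)
qed

lemma chain_form_less:
  "k < i \<Longrightarrow> chain_form k i = (if i = k + 1 \<or> i = k + 2 \<and> odd k then - 1 else 0)"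
  by (auto simp: chain_form_def)

lemma chain_form_greater:
  "i < k \<Longrightarrow> chain_form k i = (if k = i + 1 \<or> k = i + 2 \<and> odd i then 1 else 0)"
  by (auto simp: chain_form_def)

lemma if_imp_le:
  "(p \<Longrightarrow> q) \<Longrightarrow> - (if q then 1 else 0) \<le> (if p then - 1 else (0::int))"
  "(q \<Longrightarrow> p) \<Longrightarrow> (if p then - 1 else 0) \<le> - (if q then 1 else (0::int))"
  "(q \<Longrightarrow> p) \<Longrightarrow> - (if q then - 1 else 0) \<le> (if p then 1 else (0::int))"
  "(p \<Longrightarrow> q) \<Longrightarrow> (if p then 1 else 0) \<le> - (if q then - 1 else (0::int))"
  by auto

text \<open>
  Below the exchanged pair only the neighbours at distance one, and those at distance two of a
  half-step, have pairing \<open>- 1\<close>, all others \<open>0\<close>. So the claim is that these few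
  letters come last, and the delicate case is that of the two letters of index \<open>i - 2\<close>: exactly
  in odd rounds precisely one of them has pairing \<open>- 1\<close>.
\<close>
lemma swap_form_below:
  assumes sw: "swappable r Z i"
    and ab: "height r Z a < height r Z b" and bi: "height r Z b < 2 * int i"
  shows "swap_form i (r - i) a \<ge> swap_form i (r - i) b"
proof -
  have i: "i \<le> r" using sw by (simp add: swappable_def)
  have idx: "pair_index r a \<le> pair_index r b" "pair_index r b < int i"
    using height_mono[of r Z a b] ab bi height_div_2[of r Z b] by auto
  show ?thesis
  proof (cases a; cases b)
    fix k k' assume c: "a = Right k" "b = Right k'"
    have "k \<noteq> k'" using ab c by auto
    then have "k < k'" "k' < i" using idx c by auto
    then show ?thesis unfolding c by (auto simp: chain_form_less)
  next
    fix l l' assume c: "a = Left l" "b = Left l'"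
    have "l \<noteq> l'" using ab c by auto
    then have "l' < l" "r - i < l'" using idx c i by auto
    then show ?thesis unfolding c by (auto simp: chain_form_greater)
  next
    fix k l assume c: "a = Right k" "b = Left l"
    have o: "k < i" "r - i < l" "l \<le> r" "k \<le> r - l" using idx c i by auto
    have False if "i = k + 2" "l = r - i + 2" "odd k" "even (r - i)"
    proof -
      have "odd r" "odd i" "r - l = k" "int r - int l = int k" using that i by auto
      moreover have "k \<notin> Z"
        using sw \<open>odd r\<close> \<open>odd i\<close> that(1) by (auto simp: swappable_def)
      ultimately have "height r Z a = 2 * int k + 1" "height r Z b = 2 * int k"
        by (simp_all add: c)
      then show False using ab by simp
    qed
    moreover have "l = r - i + 1" if "i = k + 1" using that o i by arith
    moreover have "l = r - i + 1 \<or> l = r - i + 2" if "i = k + 2" using that o i by arith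
    ultimately have "l = r - i + 1 \<or> l = r - i + 2 \<and> odd (r - i)"
      if "i = k + 1 \<or> i = k + 2 \<and> odd k"
      using that by metis
    then show ?thesis
      unfolding c swap_form.simps chain_form_less[OF o(1)] chain_form_greater[OF o(2)]
      by (rule if_imp_le)
  next
    fix l k assume c: "a = Left l" "b = Right k"
    have o: "k < i" "r - i < l" "r \<le> l + k" using idx c i by auto
    have False if "i = k + 2" "l = r - i + 2" "odd (r - i)" "even k"
    proof -
      have "odd r" "even i" "r - l = k" "int r - int l = int k" "l \<le> r" using that i by auto
      moreover have "k \<in> Z"
        using sw \<open>odd r\<close> \<open>even i\<close> that(1) by (auto simp: swappable_def)
      ultimately have "height r Z a = 2 * int k + 1" "height r Z b = 2 * int k"
        by (simp_all add: c)
      then show False using ab by simp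
    qed
    moreover have "i = k + 1" if "l = r - i + 1" using that o i by arith
    moreover have "i = k + 1 \<or> i = k + 2" if "l = r - i + 2" using that o i by arith
    ultimately have "i = k + 1 \<or> i = k + 2 \<and> odd k"
      if "l = r - i + 1 \<or> l = r - i + 2 \<and> odd (r - i)"
      using that by metis
    then show ?thesis
      unfolding c swap_form.simps chain_form_less[OF o(1)] chain_form_greater[OF o(2)]
      by (rule if_imp_le)
  qed
qed

text \<open>
  The mirror image of \<open>swap_form_below\<close>, with pairing \<open>1\<close> for the letters that must
  come first.
\<close>
lemma swap_form_above:
  assumes sw: "swappable r Z i"
    and ai: "2 * int i + 1 < height r Z a" and ab: "height r Z a < height r Z b"
  shows "swap_form i (r - i) a \<ge> swap_form i (r - i) b"
proof -
  have i: "i \<le> r" using sw by (simp add: swappable_def)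
  have idx: "pair_index r a \<le> pair_index r b" "int i < pair_index r a"
    using height_mono[of r Z a b] ab ai height_div_2[of r Z a] by auto
  show ?thesis
  proof (cases a; cases b)
    fix k k' assume c: "a = Right k" "b = Right k'"
    have "k \<noteq> k'" using ab c by auto
    then have "k < k'" "i < k" using idx c by auto
    then show ?thesis unfolding c by (auto simp: chain_form_greater)
  next
    fix l l' assume c: "a = Left l" "b = Left l'"
    have "l \<noteq> l'" using ab c by auto
    then have "l' < l" "l < r - i" using idx c i by auto
    then show ?thesis unfolding c by (auto simp: chain_form_less)
  next
    fix k l assume c: "a = Right k" "b = Left l"
    have o: "i < k" "l < r - i" "k + l \<le> r" using idx c i by auto
    have False if "k = i + 2" "r - i = l + 2" "odd l" "even i"
    proof -
      have "r = l + (i + 2)" using that by linarith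
      then have "odd r" "r - l = k" "int r - int l = int k" "l \<le> r" "k \<le> r"
        using that by simp_all
      moreover have "k \<notin> Z"
        using sw \<open>odd r\<close> \<open>even i\<close> \<open>k \<le> r\<close> that(1) by (simp add: swappable_def)
      ultimately have "height r Z a = 2 * int k + 1" "height r Z b = 2 * int k"
        by (simp_all add: c)
      then show False using ab by simp
    qed
    moreover have "k = i + 1" if "r - i = l + 1" using that o i by arith
    moreover have "k = i + 1 \<or> k = i + 2" if "r - i = l + 2" using that o i by arith
    ultimately have "k = i + 1 \<or> k = i + 2 \<and> odd i"
      if "r - i = l + 1 \<or> r - i = l + 2 \<and> odd l"
      using that by metis
    then show ?thesis
      unfolding c swap_form.simps chain_form_greater[OF o(1)] chain_form_less[OF o(2)]
      by (rule if_imp_le)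
  next
    fix l k assume c: "a = Left l" "b = Right k"
    have o: "i < k" "l < r - i" "r \<le> l + k" using idx c i by auto
    have False if "k = i + 2" "r - i = l + 2" "even l" "odd i"
    proof -
      have "r = l + (i + 2)" using that by linarith
      then have "odd r" "r - l = k" "int r - int l = int k" "l \<le> r" "k \<le> r"
        using that by simp_all
      moreover have "k \<in> Z"
        using sw \<open>odd r\<close> \<open>odd i\<close> \<open>k \<le> r\<close> that(1) by (simp add: swappable_def)
      ultimately have "height r Z a = 2 * int k + 1" "height r Z b = 2 * int k"
        by (simp_all add: c)
      then show False using ab by simp
    qed
    moreover have "r - i = l + 1" if "k = i + 1" using that o i by arith
    moreover have "r - i = l + 1 \<or> r - i = l + 2" if "k = i + 2" using that o i by arith
    ultimately have "r - i = l + 1 \<or> r - i = l + 2 \<and> odd l"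
      if "k = i + 1 \<or> k = i + 2 \<and> odd i"
      using that by metis
    then show ?thesis
      unfolding c swap_form.simps chain_form_greater[OF o(1)] chain_form_less[OF o(2)]
      by (rule if_imp_le)
  qed
qed

section \<open>Two chains that cross each other\<close>

lemma height_less_if_pair_index_less:
  "pair_index r a < pair_index r b \<Longrightarrow> height r Z a < height r Z b"
  by (metis height_mono linorder_not_le)

lemma swap_form_bounds: "- 1 \<le> swap_form k l a" "swap_form k l a \<le> 1"
  by (cases a; simp add: chain_form_def)+

lemma height_insert:
  assumes "a \<noteq> Right i" "a \<noteq> Left (r - i)"
  shows "height r (insert i Z) a = height r Z a"
  using assms by (cases a) auto

text \<open>
  Two mutually orthogonal chains of weights, and further vectors \<open>R\<close> on which no exchange
  has an effect.
\<close>
locale crossing_chains = green_mutations \<omega> K e\<^sub>0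
  for \<omega> :: "('b \<Rightarrow>\<^sub>0 int) \<Rightarrow> ('b \<Rightarrow>\<^sub>0 int) \<Rightarrow> int"
    and K :: "'k set" and e\<^sub>0 :: "'k \<Rightarrow> 'b \<Rightarrow>\<^sub>0 int" +
  fixes \<alpha> \<beta> :: "nat \<Rightarrow> 'b \<Rightarrow>\<^sub>0 int" and m n :: nat and R :: "('b \<Rightarrow>\<^sub>0 int) multiset"
  assumes form_\<alpha>: "k \<le> m \<Longrightarrow> k' \<le> m \<Longrightarrow> \<omega> (\<alpha> k) (\<alpha> k') = chain_form k k'"
    and form_\<beta>: "l \<le> n \<Longrightarrow> l' \<le> n \<Longrightarrow> \<omega> (\<beta> l) (\<beta> l') = chain_form l l'"
    and form_\<beta>_\<alpha>: "k \<le> m \<Longrightarrow> l \<le> n \<Longrightarrow> \<omega> (\<beta> l) (\<alpha> k) = 0"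
    and effective_\<alpha>_\<beta>: "k \<le> m \<Longrightarrow> l \<le> n \<Longrightarrow> effective (\<alpha> k - \<beta> l)"
    and rest_nonpos: "k \<le> m \<Longrightarrow> l \<le> n \<Longrightarrow> v \<in># R \<Longrightarrow> \<omega> v (\<alpha> k - \<beta> l) \<le> 0"
begin

fun weight :: "letter \<Rightarrow> 'b \<Rightarrow>\<^sub>0 int" where
  "weight (Right k) = \<alpha> k"
| "weight (Left l) = \<beta> l"

lemma form_weight:
  assumes "a \<in> letters m n" "k \<le> m" "l \<le> n"
  shows "\<omega> (weight a) (\<alpha> k - \<beta> l) = swap_form k l a"
proof (cases a)
  case (Right k')
  then have "\<omega> (\<alpha> k') (\<beta> l) = 0"
    using form_\<beta>_\<alpha>[of k' l] form_skew[of "\<alpha> k'" "\<beta> l"] assms by (auto simp: letters_def)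
  then show ?thesis using Right assms form_\<alpha> by (auto simp: letters_def form_diff_right)
next
  case (Left l')
  then show ?thesis
    using assms form_\<beta> form_\<beta>_\<alpha> by (auto simp: letters_def form_diff_right)
qed

text \<open>
  Only the relative order of the letters that occur matters, so a word is described by any height
  function that sorts it.
\<close>
definition attained :: "nat \<Rightarrow> nat set \<Rightarrow> bool" where
  "attained r Z \<longleftrightarrow> (\<exists>w. set w = letters m n \<and>
     sorted_wrt (\<lambda>a b. height r Z a < height r Z b) w \<and> reachable (R + diffs (map weight w)))"

lemma attained_cong:
  assumes "attained r Z"
    and "\<And>a b. a \<in> letters m n \<Longrightarrow> b \<in> letters m n \<Longrightarrow> height r Z a < height r Z b \<Longrightarrow>
           height r' Z' a < height r' Z' b"
  shows "attained r' Z'"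
  using assms unfolding attained_def by (metis (no_types, lifting) sorted_wrt_mono_rel)

lemma attained_insert_outside:
  assumes "attained r Z" and "i \<le> r" and out: "\<not> (i \<le> m \<and> r - i \<le> n)"
  shows "attained r (insert i Z)"
proof (rule attained_cong[OF assms(1)])
  fix a b assume ab: "a \<in> letters m n" "b \<in> letters m n" "height r Z a < height r Z b"
  show "height r (insert i Z) a < height r (insert i Z) b"
  proof (cases "pair_index r a < pair_index r b")
    case False
    then have eq: "pair_index r a = pair_index r b"
      using height_mono[of r Z a b] ab(3) by simp
    have same: "height r (insert i Z) (Right k) = height r Z (Right k)"
      "height r (insert i Z) (Left l) = height r Z (Left l)"
      if mem: "Right k \<in> letters m n" "Left l \<in> letters m n"
        and eq: "pair_index r (Right k) = pair_index r (Left l)" for k l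
    proof -
      have "l \<le> r" "k = r - l" using eq by auto
      then have "k \<noteq> i" "r - l \<noteq> i"
        using mem out by (auto simp: letters_def)
      then show "height r (insert i Z) (Right k) = height r Z (Right k)"
        "height r (insert i Z) (Left l) = height r Z (Left l)" by simp_all
    qed
    show ?thesis
    proof (cases a; cases b)
      fix k l assume c: "a = Right k" "b = Left l"
      show ?thesis using ab eq same[of k l] unfolding c by metis
    next
      fix k l assume c: "a = Left l" "b = Right k"
      show ?thesis using ab eq same[of k l] unfolding c by metis
    next
      fix k k' assume c: "a = Right k" "b = Right k'"
      show ?thesis using ab(3) eq unfolding c by simp
    next
      fix l l' assume c: "a = Left l" "b = Left l'"
      show ?thesis using ab(3) eq unfolding c by simp
    qed
  qed (rule height_less_if_pair_index_less)
qed

text \<open>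
  Heights are injective and integral, so the two letters at the heights \<open>2 * i\<close> and
  \<open>2 * i + 1\<close> are adjacent, and \<open>reachable_swap\<close> applies.
\<close>
lemma attained_insert_inside:
  assumes "attained r Z" and sw: "swappable r Z i" and ins: "i \<le> m" "r - i \<le> n"
  shows "attained r (insert i Z)"
proof -
  obtain w where w: "set w = letters m n"
      "sorted_wrt (\<lambda>a b. height r Z a < height r Z b) w" "reachable (R + diffs (map weight w))"
    using assms(1) unfolding attained_def by blast
  let ?x = "Left (r - i)" and ?y = "Right i"
  have ir: "i \<le> r" "i \<notin> Z" using sw by (auto simp: swappable_def)
  have hx: "height r Z ?x = 2 * int i" and hy: "height r Z ?y = 2 * int i + 1"
    using ir by auto
  have "?y \<in> set w" using w(1) ins by (simp add: letters_def)
  then obtain us' vs where w': "w = us' @ ?y # vs" by (meson split_list)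
  have "?x \<in> set us'"
  proof -
    have "?x \<in> set us' \<union> {?y} \<union> set vs" using w(1) w' ins by (auto simp: letters_def)
    moreover have "?x \<notin> set vs"
      using w(2) hx hy unfolding w' by (auto simp: sorted_wrt_append)
    ultimately show ?thesis by auto
  qed
  then obtain us ws where us': "us' = us @ ?x # ws" by (meson split_list)
  have "ws = []"
  proof (rule ccontr)
    assume "ws \<noteq> []"
    then have "height r Z ?x < height r Z (hd ws)" "height r Z (hd ws) < height r Z ?y"
      using w(2) unfolding w' us' by (auto simp: sorted_wrt_append)
    then show False using hx hy by linarith
  qed
  then have w'': "w = us @ ?x # ?y # vs" using w' us' by simp
  have sorted: "sorted_wrt (\<lambda>a b. height r Z a < height r Z b) us"
      "sorted_wrt (\<lambda>a b. height r Z a < height r Z b) vs"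
    and below: "\<And>a. a \<in> set us \<Longrightarrow> height r Z a < 2 * int i"
    and above: "\<And>a. a \<in> set vs \<Longrightarrow> 2 * int i + 1 < height r Z a"
    using w(2) hx hy unfolding w'' by (auto simp: sorted_wrt_append simp del: height.simps)
  have split: "a \<in> set us \<or> a \<in> set vs \<or> a = ?x \<or> a = ?y" if "a \<in> letters m n" for a
    using that w(1) w'' by auto
  have in_us: "a \<in> set us" if "a \<in> letters m n" "height r Z a < 2 * int i" for a
    using split[OF that(1)] that(2) hx hy above[of a] by (elim disjE) (simp_all del: height.simps)
  have in_vs: "a \<in> set vs" if "a \<in> letters m n" "2 * int i + 1 < height r Z a" for a
    using split[OF that(1)] that(2) hx hy below[of a] by (elim disjE) (simp_all del: height.simps)
  have sub: "set us \<subseteq> letters m n" "set vs \<subseteq> letters m n" using w(1) w'' by auto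
  let ?g = "swap_form i (r - i)"
  have dec_us: "sorted_wrt (\<lambda>a b. ?g a \<ge> ?g b) us"
    using sorted(1) by (rule sorted_wrt_mono_rel[rotated]) (use swap_form_below[OF sw] below in blast)
  have dec_vs: "sorted_wrt (\<lambda>a b. ?g a \<ge> ?g b) vs"
    using sorted(2) by (rule sorted_wrt_mono_rel[rotated]) (use swap_form_above[OF sw] above in blast)
  have last: "?g (last us) = - 1" if "us \<noteq> []"
  proof -
    have mem: "last us \<in> letters m n" using sub(1) that by auto
    have idx: "pair_index r (last us) < int i"
      using below[OF last_in_set[OF that]] height_div_2[of r Z "last us"] by linarith
    have "\<exists>c\<in>set us. ?g c = - 1"
    proof (cases "last us")
      case (Right k)
      then have "k < i" using idx by simp
      have "Right (i - 1) \<in> set us"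
        using ins \<open>k < i\<close> by (intro in_us) (auto simp: letters_def)
      moreover have "?g (Right (i - 1)) = - 1" using \<open>k < i\<close> by (simp add: chain_form_less)
      ultimately show ?thesis by blast
    next
      case (Left l)
      then have l: "r - i < l" "l \<le> n"
        using idx mem ir by (auto simp: letters_def)
      have "Left (Suc (r - i)) \<in> set us"
      proof (rule in_us)
        show "Left (Suc (r - i)) \<in> letters m n" using l by (auto simp: letters_def)
        have "pair_index r (Left (Suc (r - i))) < int i" using ir by simp
        then show "height r Z (Left (Suc (r - i))) < 2 * int i"
          using height_div_2[of r Z "Left (Suc (r - i))"] by linarith
      qed
      moreover have "?g (Left (Suc (r - i))) = - 1" by (simp add: chain_form_def)
      ultimately show ?thesis by blast
    qed
    then obtain c where c: "c \<in> set us" "?g c = - 1" by blast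
    have "us = butlast us @ [last us]" using that by simp
    then have "?g (last us) \<le> ?g c"
      using dec_us c(1) by (metis (no_types, lifting) UnE empty_iff list.set(1) order_refl set_append
        set_ConsD sorted_wrt_append list.set_intros(1))
    then show ?thesis using swap_form_bounds(1)[of i "r - i" "last us"] c(2) by simp
  qed
  have hd: "?g (hd vs) = 1" if "vs \<noteq> []"
  proof -
    have mem: "hd vs \<in> letters m n" using sub(2) that by auto
    have idx: "int i < pair_index r (hd vs)"
      using above[OF hd_in_set[OF that]] height_div_2[of r Z "hd vs"] by linarith
    have "\<exists>c\<in>set vs. ?g c = 1"
    proof (cases "hd vs")
      case (Right k)
      then have k: "i < k" "k \<le> m"
        using idx mem by (auto simp: letters_def)
      then have "Right (Suc i) \<in> set vs" by (intro in_vs) (auto simp: letters_def)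
      moreover have "?g (Right (Suc i)) = 1" by (simp add: chain_form_def)
      ultimately show ?thesis by blast
    next
      case (Left l)
      then have l: "l < r - i" using idx ir by auto
      have "Left (r - i - 1) \<in> set vs"
      proof (rule in_vs)
        show "Left (r - i - 1) \<in> letters m n" using ins by (auto simp: letters_def)
        have "int i < pair_index r (Left (r - i - 1))" using ir l by simp
        then show "2 * int i + 1 < height r Z (Left (r - i - 1))"
          using height_div_2[of r Z "Left (r - i - 1)"] by linarith
      qed
      moreover have "r - i = r - i - 1 + 1" using l by simp
      then have "?g (Left (r - i - 1)) = 1"
        using chain_form_less[of "r - i - 1" "r - i"] by simp
      ultimately show ?thesis by blast
    qed
    then obtain c where c: "c \<in> set vs" "?g c = 1" by blast
    have "vs = hd vs # tl vs" using that by simp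
    then have "?g c \<le> ?g (hd vs)"
      using dec_vs c(1) by (metis order_refl set_ConsD sorted_wrt.simps(2))
    then show ?thesis using swap_form_bounds(2)[of i "r - i" "hd vs"] c(2) by simp
  qed
  have form: "\<omega> (weight a) (\<alpha> i - \<beta> (r - i)) = ?g a" if "a \<in> letters m n" for a
    by (rule form_weight[OF that ins])
  have "reachable (R + diffs (map weight us @ \<alpha> i # \<beta> (r - i) # map weight vs))"
  proof (rule reachable_swap)
    show "reachable (R + diffs (map weight us @ \<beta> (r - i) # \<alpha> i # map weight vs))"
      using w(3) w'' by simp
    show "effective (\<alpha> i - \<beta> (r - i))" by (rule effective_\<alpha>_\<beta>[OF ins])
    show "\<And>v. v \<in># R \<Longrightarrow> \<omega> v (\<alpha> i - \<beta> (r - i)) \<le> 0" by (rule rest_nonpos[OF ins])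
    show "\<omega> (\<beta> (r - i)) (\<alpha> i) = 0" by (rule form_\<beta>_\<alpha>[OF ins])
    show "sorted_wrt (\<lambda>a b. \<omega> b (\<alpha> i - \<beta> (r - i)) \<le> \<omega> a (\<alpha> i - \<beta> (r - i))) (map weight us)"
      unfolding sorted_wrt_map using dec_us
      by (rule sorted_wrt_mono_rel[rotated]) (simp add: form subsetD[OF sub(1)])
    show "sorted_wrt (\<lambda>a b. \<omega> b (\<alpha> i - \<beta> (r - i)) \<le> \<omega> a (\<alpha> i - \<beta> (r - i))) (map weight vs)"
      unfolding sorted_wrt_map using dec_vs
      by (rule sorted_wrt_mono_rel[rotated]) (simp add: form subsetD[OF sub(2)])
    show "\<omega> (last (map weight us)) (\<alpha> i - \<beta> (r - i)) = - 1" if "map weight us \<noteq> []"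
      using that last by (simp add: last_map form subsetD[OF sub(1)])
    show "\<omega> (hd (map weight vs)) (\<alpha> i - \<beta> (r - i)) = 1" if "map weight vs \<noteq> []"
      using that hd by (simp add: hd_map form subsetD[OF sub(2)])
  qed
  moreover have "sorted_wrt (\<lambda>a b. height r (insert i Z) a < height r (insert i Z) b)
      (us @ ?y # ?x # vs)"
  proof -
    have other: "height r (insert i Z) a = height r Z a" if "a \<in> set us \<union> set vs" for a
      using that below[of a] above[of a] hx hy by (intro height_insert) auto
    have "height r (insert i Z) ?y = 2 * int i" "height r (insert i Z) ?x = 2 * int i + 1"
      using ir by auto
    moreover have "sorted_wrt (\<lambda>a b. height r (insert i Z) a < height r (insert i Z) b) us"
      using sorted(1) by (rule sorted_wrt_mono_rel[rotated]) (simp add: other)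
    moreover have "sorted_wrt (\<lambda>a b. height r (insert i Z) a < height r (insert i Z) b) vs"
      using sorted(2) by (rule sorted_wrt_mono_rel[rotated]) (simp add: other)
    ultimately show ?thesis
      using below above other
      by (fastforce simp: sorted_wrt_append simp del: height.simps)
  qed
  moreover have "set (us @ ?y # ?x # vs) = letters m n" using w(1) w'' by auto
  ultimately show ?thesis unfolding attained_def by (intro exI[of _ "us @ ?y # ?x # vs"]) simp
qed

lemma attained_insert: "attained r Z \<Longrightarrow> swappable r Z i \<Longrightarrow> attained r (insert i Z)"
  using attained_insert_inside attained_insert_outside unfolding swappable_def by blast

lemma attained_round:
  assumes "attained r {}"
  shows "attained r {..r}"
proof -
  have odds: "attained r {k. odd k \<and> k \<le> r \<and> r < k + j}" if "j \<le> Suc r" for j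
    using that
  proof (induction j)
    case 0
    have empty: "{k. odd k \<and> k \<le> r \<and> r < k + 0} = {}" by auto
    show ?case unfolding empty by (rule assms)
  next
    case (Suc j)
    let ?Z = "\<lambda>j. {k. odd k \<and> k \<le> r \<and> r < k + j}"
    have Z: "?Z (Suc j) = (if odd (r - j) then insert (r - j) (?Z j) else ?Z j)"
    proof -
      have iff: "k \<le> r \<and> r < k + Suc j \<longleftrightarrow> k = r - j \<or> k \<le> r \<and> r < k + j" for k
        using Suc.prems by arith
      show ?thesis unfolding iff by auto
    qed
    have "swappable (i + j) {k. odd k \<and> k \<le> i + j \<and> i + j < k + j} i" if "odd i" for i
      using that by (auto simp: swappable_def)
    from this[of "r - j"] have "swappable r (?Z j) (r - j)" if "odd (r - j)"
      using that Suc.prems by simp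
    then show ?case
      using attained_insert[OF Suc.IH[OF Suc_leD[OF Suc.prems]], of "r - j"]
        Suc.IH[OF Suc_leD[OF Suc.prems]]
      by (cases "odd (r - j)") (simp_all only: Z if_True if_False simp_thms)
  qed
  have evens: "attained r {k. k \<le> r \<and> (odd k \<or> k < j)}" if "j \<le> Suc r" for j
    using that
  proof (induction j)
    case 0
    have "{k. odd k \<and> k \<le> r \<and> r < k + Suc r} = {k. k \<le> r \<and> (odd k \<or> k < 0)}"
      by auto
    then show ?case using odds[OF order_refl] by metis
  next
    case (Suc j)
    let ?Z = "\<lambda>j. {k. k \<le> r \<and> (odd k \<or> k < j)}"
    have Z: "?Z (Suc j) = (if even j then insert j (?Z j) else ?Z j)"
      using Suc.prems by (auto simp: less_Suc_eq)
    have "swappable r (?Z j) j" if "even j"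
      unfolding swappable_def using that Suc.prems by auto
    then show ?case
      using attained_insert[OF Suc.IH[OF Suc_leD[OF Suc.prems]], of j]
        Suc.IH[OF Suc_leD[OF Suc.prems]]
      by (cases "even j") (simp_all only: Z if_True if_False simp_thms)
  qed
  have "{k. k \<le> r \<and> (odd k \<or> k < Suc r)} = {..r}" by auto
  then show ?thesis using evens[OF order_refl] by metis
qed

text \<open>
  Once every pair of round \<open>r\<close> has been exchanged, regrouping the letters into the pairs of
  the next round does not change their order.
\<close>
lemma attained_next_round:
  assumes "attained r {..r}"
  shows "attained (Suc r) {}"
proof (rule attained_cong[OF assms])
  fix a b assume h: "height r {..r} a < height r {..r} b"
  then show "height (Suc r) {} a < height (Suc r) {} b"
    by (cases a; cases b) (auto split: if_splits)
qed

theorem reachable_cross: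
  assumes "reachable (R + diffs (map \<beta> (rev [0..<Suc n]) @ map \<alpha> [0..<Suc m]))"
  shows "reachable (R + diffs (map \<alpha> [0..<Suc m] @ map \<beta> (rev [0..<Suc n])))"
proof -
  have letters: "set (map Right [0..<Suc m]) \<union> set (map Left (rev [0..<Suc n])) = letters m n"
    by (auto simp: letters_def simp del: upt_Suc)
  have rev: "sorted_wrt (\<lambda>a b. b < a) (rev [0..<Suc n])"
    by (simp add: sorted_wrt_rev del: upt_Suc)
  have mono: "sorted_wrt (\<lambda>a b. height r {} a < height r {} b) (map Right [0..<Suc m])"
    "sorted_wrt (\<lambda>a b. height r {} a < height r {} b) (map Left (rev [0..<Suc n]))" for r
    unfolding sorted_wrt_map
    by (rule sorted_wrt_mono_rel[OF _ sorted_wrt_upt], simp,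
        rule sorted_wrt_mono_rel[OF _ rev], simp)
  have start: "attained 0 {}"
    unfolding attained_def
  proof (intro exI[of _ "map Left (rev [0..<Suc n]) @ map Right [0..<Suc m]"] conjI)
    show "sorted_wrt (\<lambda>a b. height 0 {} a < height 0 {} b)
        (map Left (rev [0..<Suc n]) @ map Right [0..<Suc m])"
      using mono[of 0] by (auto simp: sorted_wrt_append simp del: upt_Suc)
  qed (use letters assms in \<open>auto simp: comp_def simp del: upt_Suc\<close>)
  have "attained r {}" for r
    by (induction r) (use start attained_round attained_next_round in auto)
  then obtain w where w: "set w = letters m n"
      "sorted_wrt (\<lambda>a b. height (Suc (m + n)) {} a < height (Suc (m + n)) {} b) w"
      "reachable (R + diffs (map weight w))"
    unfolding attained_def by blast
  let ?w = "map Right [0..<Suc m] @ map Left (rev [0..<Suc n])"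
  let ?h = "height (Suc (m + n)) {}"
  have "sorted_wrt (\<lambda>a b. ?h a < ?h b) ?w"
    using mono[of "Suc (m + n)"] by (auto simp: sorted_wrt_append simp del: upt_Suc)
  then have "map ?h w = map ?h ?w"
    using w(1,2) letters
    by (intro strict_sorted_equal) (simp_all only: sorted_wrt_map set_map set_append)
  moreover have "inj_on ?h (set w \<union> set ?w)" by (intro inj_onI) (rule height_inj)
  ultimately have "w = ?w" by (metis map_inj_on)
  then show ?thesis using w(3) by (simp add: comp_def del: upt_Suc)
qed

end

section \<open>The Toda chain of a single gauge node\<close>

definition cartan :: "int \<Rightarrow> int \<Rightarrow> int" where
  "cartan a b = (if a = b then 2 else if a = b + 1 \<or> b = a + 1 then - 1 else 0)"

lemma sum_telescope_two:
  fixes h :: "int \<Rightarrow> 'c :: ab_group_add"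
  shows "(\<Sum>r<N. h (int r + 1) - h (int r - 1)) = h (int N) + h (int N - 1) - h 0 - h (- 1)"
  by (induction N) (simp_all add: algebra_simps)

text \<open>
  The vectors \<open>s\<close> and \<open>t\<close> of one gauge node of dimension \<open>d\<close>, with indices
  strictly between \<open>0\<close> and \<open>d\<close>; at \<open>d = 1\<close> the chain is empty.
\<close>
locale toda_node = green_mutations \<omega> K e\<^sub>0
  for \<omega> :: "('b \<Rightarrow>\<^sub>0 int) \<Rightarrow> ('b \<Rightarrow>\<^sub>0 int) \<Rightarrow> int"
    and K :: "'k set" and e\<^sub>0 :: "'k \<Rightarrow> 'b \<Rightarrow>\<^sub>0 int" +
  fixes s t :: "nat \<Rightarrow> 'b \<Rightarrow>\<^sub>0 int" and d :: nat
  assumes d_pos: "1 \<le> d"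
    and form_s_s: "0 < a \<Longrightarrow> a < d \<Longrightarrow> 0 < b \<Longrightarrow> b < d \<Longrightarrow> \<omega> (s a) (s b) = 0"
    and form_t_t: "0 < a \<Longrightarrow> a < d \<Longrightarrow> 0 < b \<Longrightarrow> b < d \<Longrightarrow> \<omega> (t a) (t b) = 0"
    and form_s_t: "0 < a \<Longrightarrow> a < d \<Longrightarrow> 0 < b \<Longrightarrow> b < d \<Longrightarrow> \<omega> (s a) (t b) = cartan (int a) (int b)"
    and effective_s: "0 < a \<Longrightarrow> a < d \<Longrightarrow> effective (s a)"
    and effective_t: "0 < a \<Longrightarrow> a < d \<Longrightarrow> effective (t a)"
begin

text \<open>
  The vectors mutated in the rounds satisfy
  \<open>\<sigma> (r + 1) n + \<sigma> (r - 1) n = \<sigma> r (n + 1) + \<sigma> r (n - 1)\<close> with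
  \<open>\<sigma> 0 = s\<close>, \<open>\<sigma> (- 1) = - t\<close> and zero boundary values at \<open>0\<close> and \<open>d\<close>.
  By d'Alembert's formula \<open>\<sigma> r n = wave (r + n) - wave (r - n)\<close> for a profile of period
  \<open>2 * d\<close>. The initial values determine the profile on each parity class by the zigzag
  \<open>0, - 2, 2, - 4, 4, \<dots>\<close> and \<open>- 1, 1, - 3, 3, \<dots>\<close>, along which it grows by one
  vector \<open>s\<close> or \<open>t\<close> at a time; \<open>rank\<close> is the position in the zigzag.
\<close>
definition increment :: "int \<Rightarrow> nat \<Rightarrow> 'b \<Rightarrow>\<^sub>0 int" where
  "increment k j = (if even (int j + k) then s j else t j)"

definition rank :: "int \<Rightarrow> nat" where
  "rank k = (if k \<ge> 0 then nat k else nat (- k - 1))"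

definition wave :: "int \<Rightarrow> 'b \<Rightarrow>\<^sub>0 int" where
  "wave k = (let k' = (k + int d) mod (2 * int d) - int d in \<Sum>j\<in>{1..rank k'}. increment k' j)"

definition \<sigma> :: "int \<Rightarrow> int \<Rightarrow> 'b \<Rightarrow>\<^sub>0 int" where
  "\<sigma> r n = wave (r + n) - wave (r - n)"

lemma wave_periodic: "wave (k - 2 * int d) = wave k"
proof -
  have "(k - 2 * int d + int d) mod (2 * int d) = (k + int d) mod (2 * int d)"
    using mod_add_self2[of "k - 2 * int d + int d" "2 * int d"] by (simp add: algebra_simps)
  then show ?thesis by (simp add: wave_def)
qed

lemma wave_eq: "- int d \<le> k \<Longrightarrow> k < int d \<Longrightarrow> wave k = (\<Sum>j\<in>{1..rank k}. increment k j)"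
  by (simp add: wave_def Let_def)

lemma increment_cong: "even (k - k') \<Longrightarrow> increment k = increment k'"
  by (auto simp: increment_def fun_eq_iff)

lemma sum_increment_diff:
  assumes "a \<le> b"
  shows "(\<Sum>j\<in>{1..b}. increment k j) - (\<Sum>j\<in>{1..a}. increment k j) = (\<Sum>j\<in>{a<..b}. increment k j)"
proof -
  have "{1..b} = {1..a} \<union> {a<..b}" using assms by auto
  then have "(\<Sum>j\<in>{1..b}. increment k j) = (\<Sum>j\<in>{1..a}. increment k j) + (\<Sum>j\<in>{a<..b}. increment k j)"
    by (simp only:) (rule sum.union_disjoint, auto)
  then show ?thesis by simp
qed

lemma wave_diff:
  assumes "- int d \<le> k" "k < int d" "- int d \<le> k'" "k' < int d" "even (k - k')" "rank k' \<le> rank k"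
  shows "wave k - wave k' = (\<Sum>j\<in>{rank k'<..rank k}. increment k j)"
  unfolding wave_eq[OF assms(1,2)] wave_eq[OF assms(3,4)] increment_cong[OF assms(5)]
  by (rule sum_increment_diff[OF assms(6)])

lemma \<sigma>_start: "0 < n \<Longrightarrow> n < d \<Longrightarrow> \<sigma> 0 (int n) = s n"
proof -
  assume n: "0 < n" "n < d"
  have "{rank (- int n)<..rank (int n)} = {n}" using n by (auto simp: rank_def)
  moreover have "rank (- int n) \<le> rank (int n)" using n by (auto simp: rank_def)
  ultimately show ?thesis using n wave_diff[of "int n" "- int n"] by (simp add: \<sigma>_def increment_def)
qed

lemma \<sigma>_before: "0 < n \<Longrightarrow> n < d \<Longrightarrow> \<sigma> (- 1) (int n) = - t n"
proof -
  assume n: "0 < n" "n < d"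
  have "{rank (int n - 1)<..rank (- 1 - int n)} = {n}" using n by (auto simp: rank_def)
  moreover have "rank (int n - 1) \<le> rank (- 1 - int n)" using n by (auto simp: rank_def)
  ultimately have "wave (- 1 - int n) - wave (int n - 1) = t n"
    using n wave_diff[of "- 1 - int n" "int n - 1"] by (simp add: increment_def)
  then show ?thesis by (simp add: \<sigma>_def algebra_simps)
qed

lemma \<sigma>_recursion: "\<sigma> (r + 1) n = \<sigma> r (n + 1) + \<sigma> r (n - 1) - \<sigma> (r - 1) n"
  by (simp add: \<sigma>_def algebra_simps)

lemma \<sigma>_boundary: "\<sigma> r 0 = 0" "\<sigma> r (int d) = 0"
  using wave_periodic[of "r + int d"] by (simp_all add: \<sigma>_def algebra_simps)

lemma \<sigma>_end: "0 < n \<Longrightarrow> n < d \<Longrightarrow> \<sigma> (int d) (int n) = - s (d - n)"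
proof -
  assume n: "0 < n" "n < d"
  have "\<sigma> (int d) (int n) = - \<sigma> 0 (int (d - n))"
    using wave_periodic[of "int d + int n"] n by (simp add: \<sigma>_def algebra_simps of_nat_diff)
  then show ?thesis using n \<sigma>_start[of "d - n"] by simp
qed

lemma \<sigma>_before_end: "0 < n \<Longrightarrow> n < d \<Longrightarrow> \<sigma> (int d - 1) (int n) = t (d - n)"
proof -
  assume n: "0 < n" "n < d"
  have "\<sigma> (int d - 1) (int n) = - \<sigma> (- 1) (int (d - n))"
    using wave_periodic[of "int d - 1 + int n"] n by (simp add: \<sigma>_def algebra_simps of_nat_diff)
  then show ?thesis using n \<sigma>_before[of "d - n"] by simp
qed

text \<open>
  The profile grows along the zigzag, so it suffices to compare ranks. For \<open>r + n \<ge> d\<close> the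
  argument \<open>r + n\<close> first has to be moved into the fundamental period.
\<close>
lemma effective_\<sigma>:
  assumes "0 < n" "n < d" "r < d"
  shows "effective (\<sigma> (int r) (int n))"
proof -
  define k where "k = (if r + n < d then int r + int n else int r + int n - 2 * int d)"
  let ?k' = "int r - int n"
  have k: "- int d \<le> k" "k < int d" "- int d \<le> ?k'" "?k' < int d"
    using assms by (auto simp: k_def)
  have "rank ?k' \<le> rank k" "rank k < d" using assms by (auto simp: rank_def k_def)
  moreover have "even (k - ?k')" by (simp add: k_def)
  moreover have "\<sigma> (int r) (int n) = wave k - wave ?k'"
    using wave_periodic[of "int r + int n"] by (simp add: \<sigma>_def k_def)
  ultimately have "\<sigma> (int r) (int n) = (\<Sum>j\<in>{rank ?k'<..rank k}. increment k j)" "rank k < d"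
    using wave_diff[OF k] by simp_all
  moreover have "effective (increment k j)" if "0 < j" "j < d" for j
    using that effective_s effective_t by (simp add: increment_def)
  ultimately show ?thesis by (auto intro: effective_sum)
qed

lemma wave_ends: "wave 0 = 0" "wave (- 1) = 0"
    "wave (int d) + wave (int d - 1) = (\<Sum>j\<in>{1..<d}. s j + t j)"
proof -
  show "wave 0 = 0" "wave (- 1) = 0" using d_pos by (simp_all add: wave_eq rank_def)
  have "wave (int d) = (\<Sum>j\<in>{1..<d}. increment (- int d) j)"
  proof -
    have "{1..rank (- int d)} = {1..<d}" using d_pos by (auto simp: rank_def)
    then show ?thesis using wave_periodic[of "int d"] wave_eq[of "- int d"] d_pos by simp
  qed
  moreover have "wave (int d - 1) = (\<Sum>j\<in>{1..<d}. increment (int d - 1) j)"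
  proof -
    have "{1..rank (int d - 1)} = {1..<d}" using d_pos by (auto simp: rank_def)
    then show ?thesis using wave_eq[of "int d - 1"] d_pos by simp
  qed
  ultimately show "wave (int d) + wave (int d - 1) = (\<Sum>j\<in>{1..<d}. s j + t j)"
    by (auto simp flip: sum.distrib simp: increment_def intro!: sum.cong)
qed

text \<open>
  Over all rounds the contributions telescope to the sum of the two final values of the profile,
  one on each parity class, which together contain every \<open>s\<close> and \<open>t\<close> once.
\<close>
lemma sum_\<sigma>_first: "(\<Sum>r<d. \<sigma> (int r) 1) = (\<Sum>j\<in>{1..<d}. s j + t j)"
  using sum_telescope_two[of wave d] wave_ends by (simp add: \<sigma>_def)

lemma sum_\<sigma>_last: "(\<Sum>r<d. \<sigma> (int r) (int d - 1)) = (\<Sum>j\<in>{1..<d}. s j + t j)"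
proof -
  let ?h = "\<lambda>k. wave (k - int d)"
  have "\<sigma> (int r) (int d - 1) = - (?h (int r + 1) - ?h (int r - 1))" for r
    using wave_periodic[of "int r + (int d - 1)"] by (simp add: \<sigma>_def algebra_simps)
  then have "(\<Sum>r<d. \<sigma> (int r) (int d - 1)) = - (?h (int d) + ?h (int d - 1) - ?h 0 - ?h (- 1))"
    by (simp only: sum_negf sum_telescope_two[of ?h d])
  also have "\<dots> = wave (int d) + wave (int d - 1)"
    using wave_periodic[of "int d"] wave_periodic[of "int d - 1"] wave_ends
    by (simp add: algebra_simps)
  finally show ?thesis using wave_ends by simp
qed

text \<open>
  The Cartan matrix of type A, extended by zero to the two boundary positions.
\<close>
definition inner_cartan :: "int \<Rightarrow> int \<Rightarrow> int" where
  "inner_cartan a b = (if 0 < a \<and> a < int d \<and> 0 < b \<and> b < int d then cartan a b else 0)"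

text \<open>
  The exchange matrix is the same in every round: the recursion preserves the pairings because the
  Cartan matrix commutes with the adjacency matrix of its diagram.
\<close>
lemma \<sigma>_forms:
  assumes "0 \<le> a" "a \<le> int d" "0 \<le> b" "b \<le> int d"
  shows "\<omega> (\<sigma> (int r) a) (\<sigma> (int r) b) = 0 \<and> \<omega> (\<sigma> (int r - 1) a) (\<sigma> (int r - 1) b) = 0 \<and>
    \<omega> (\<sigma> (int r - 1) a) (\<sigma> (int r) b) = inner_cartan a b"
proof -
  have *: "\<forall>a\<in>{0..int d}. \<forall>b\<in>{0..int d}.
    \<omega> (\<sigma> (int r) a) (\<sigma> (int r) b) = 0 \<and> \<omega> (\<sigma> (int r - 1) a) (\<sigma> (int r - 1) b) = 0 \<and>
    \<omega> (\<sigma> (int r - 1) a) (\<sigma> (int r) b) = inner_cartan a b"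
  proof (induction r)
    case 0
    show ?case
    proof (intro ballI)
      fix a b assume ab: "a \<in> {0..int d}" "b \<in> {0..int d}"
      show "\<omega> (\<sigma> (int 0) a) (\<sigma> (int 0) b) = 0 \<and> \<omega> (\<sigma> (int 0 - 1) a) (\<sigma> (int 0 - 1) b) = 0 \<and>
        \<omega> (\<sigma> (int 0 - 1) a) (\<sigma> (int 0) b) = inner_cartan a b"
      proof (cases "0 < a \<and> a < int d \<and> 0 < b \<and> b < int d")
        case True
        then obtain i j where ij: "a = int i" "b = int j" "0 < i" "i < d" "0 < j" "j < d"
          by (metis of_nat_0_less_iff of_nat_less_iff pos_int_cases)
        have "\<omega> (t i) (s j) = - cartan (int i) (int j)"
          using form_skew[of "t i" "s j"] form_s_t[of j i] ij by (simp add: cartan_def)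
        then show ?thesis using ij True
          by (simp add: \<sigma>_start \<sigma>_before form_s_s form_t_t inner_cartan_def
              form_uminus_left form_uminus_right)
      next
        case False
        then have "a = 0 \<or> a = int d \<or> b = 0 \<or> b = int d" using ab by auto
        then have "(\<forall>k. \<sigma> k a = 0) \<or> (\<forall>k. \<sigma> k b = 0)"
          using \<sigma>_boundary by metis
        moreover have "inner_cartan a b = 0" using False by (auto simp: inner_cartan_def)
        ultimately show ?thesis by (auto simp: form_zero_left form_zero_right)
      qed
    qed
  next
    case (Suc r)
    show ?case
    proof (intro ballI)
      fix a b assume ab: "a \<in> {0..int d}" "b \<in> {0..int d}"
      show "\<omega> (\<sigma> (int (Suc r)) a) (\<sigma> (int (Suc r)) b) = 0 \<and>
        \<omega> (\<sigma> (int (Suc r) - 1) a) (\<sigma> (int (Suc r) - 1) b) = 0 \<and>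
        \<omega> (\<sigma> (int (Suc r) - 1) a) (\<sigma> (int (Suc r)) b) = inner_cartan a b"
      proof (cases "0 < a \<and> a < int d \<and> 0 < b \<and> b < int d")
        case True
        have rec: "\<sigma> (int (Suc r)) c = \<sigma> (int r) (c + 1) + \<sigma> (int r) (c - 1) - \<sigma> (int r - 1) c" for c
          using \<sigma>_recursion[of "int r" c] by (simp add: algebra_simps)
        have IH: "\<omega> (\<sigma> (int r) a) (\<sigma> (int r) b) = 0" "\<omega> (\<sigma> (int r - 1) a) (\<sigma> (int r - 1) b) = 0"
          "\<omega> (\<sigma> (int r - 1) a) (\<sigma> (int r) b) = inner_cartan a b"
          "\<omega> (\<sigma> (int r) a) (\<sigma> (int r - 1) b) = - inner_cartan b a"
          if "0 \<le> a" "a \<le> int d" "0 \<le> b" "b \<le> int d" for a b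
          using Suc.IH that form_skew[of "\<sigma> (int r) a" "\<sigma> (int r - 1) b"] by auto
        have "inner_cartan b (a + 1) + inner_cartan b (a - 1) =
            inner_cartan a (b + 1) + inner_cartan a (b - 1)"
          using True by (auto simp: inner_cartan_def cartan_def)
        moreover have "inner_cartan b a = inner_cartan a b"
          by (auto simp: inner_cartan_def cartan_def)
        ultimately show ?thesis
          using True unfolding rec by (simp add: form_simps IH)
      next
        case False
        then have "a = 0 \<or> a = int d \<or> b = 0 \<or> b = int d" using ab by auto
        then have "(\<forall>k. \<sigma> k a = 0) \<or> (\<forall>k. \<sigma> k b = 0)"
          using \<sigma>_boundary by metis
        moreover have "inner_cartan a b = 0" using False by (auto simp: inner_cartan_def)
        ultimately show ?thesis by (auto simp: form_zero_left form_zero_right)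
      qed
    qed
  qed
  then show ?thesis using assms by auto
qed

text \<open>
  A vector outside the node that is seen by \<open>s\<close> and \<open>t\<close> only at position
  \<open>p\<close>, like an arrow ending at the node; \<open>p = 0\<close> stands for a vector that is
  orthogonal to the node.
\<close>
definition attached :: "nat \<Rightarrow> ('b \<Rightarrow>\<^sub>0 int) \<Rightarrow> bool" where
  "attached p v \<longleftrightarrow> p < d \<and> (\<forall>b. 0 < b \<longrightarrow> b < d \<longrightarrow>
     \<omega> v (s b) = (if b = p then 1 else 0) \<and> \<omega> v (t b) = - (if b = p then 1 else 0))"

definition moved :: "nat \<Rightarrow> nat \<Rightarrow> ('b \<Rightarrow>\<^sub>0 int) \<Rightarrow> ('b \<Rightarrow>\<^sub>0 int)" where
  "moved p r v = v + (\<Sum>j<r. \<sigma> (int j) (int p))"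

text \<open>
  A vector stays attached at the same position to the current pair of rounds, so it gains
  \<open>\<sigma> r p\<close> in every round \<open>r\<close>.
\<close>
lemma moved_forms:
  assumes v: "attached p v" and b: "0 \<le> b" "b \<le> int d"
  shows "\<omega> (moved p r v) (\<sigma> (int r) b) = (if 0 < b \<and> b < int d \<and> b = int p then 1 else 0)"
    and "\<omega> (moved p r v) (\<sigma> (int r - 1) b) = (if 0 < b \<and> b < int d \<and> b = int p then 1 else 0)"
proof -
  let ?\<delta> = "\<lambda>b. if 0 < b \<and> b < int d \<and> b = int p then 1 else 0 :: int"
  have p: "p < d" using v by (simp add: attached_def)
  have "\<forall>b\<in>{0..int d}. \<omega> (moved p r v) (\<sigma> (int r) b) = ?\<delta> b \<and>
      \<omega> (moved p r v) (\<sigma> (int r - 1) b) = ?\<delta> b"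
  proof (induction r)
    case 0
    show ?case
    proof
      fix b assume b: "b \<in> {0..int d}"
      show "\<omega> (moved p 0 v) (\<sigma> (int 0) b) = ?\<delta> b \<and> \<omega> (moved p 0 v) (\<sigma> (int 0 - 1) b) = ?\<delta> b"
      proof (cases "0 < b \<and> b < int d")
        case True
        then obtain j where "b = int j" "0 < j" "j < d"
          by (metis of_nat_0_less_iff of_nat_less_iff pos_int_cases)
        then show ?thesis using v
          by (simp add: moved_def attached_def \<sigma>_start \<sigma>_before form_uminus_right)
      next
        case False
        then have "\<forall>k. \<sigma> k b = 0" using b \<sigma>_boundary by (metis atLeastAtMost_iff order_le_less)
        then show ?thesis using False by (auto simp: form_zero_right)
      qed
    qed
  next
    case (Suc r)
    show ?case
    proof
      fix b assume b: "b \<in> {0..int d}"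
      show "\<omega> (moved p (Suc r) v) (\<sigma> (int (Suc r)) b) = ?\<delta> b \<and>
        \<omega> (moved p (Suc r) v) (\<sigma> (int (Suc r) - 1) b) = ?\<delta> b"
      proof (cases "0 < b \<and> b < int d")
        case True
        have mv: "moved p (Suc r) v = moved p r v + \<sigma> (int r) (int p)"
          by (simp add: moved_def add.assoc)
        have rec: "\<sigma> (int (Suc r)) b = \<sigma> (int r) (b + 1) + \<sigma> (int r) (b - 1) - \<sigma> (int r - 1) b"
          using \<sigma>_recursion[of "int r" b] by (simp add: algebra_simps)
        have \<sigma>: "\<omega> (\<sigma> (int r) (int p)) (\<sigma> (int r) c) = 0"
          "\<omega> (\<sigma> (int r) (int p)) (\<sigma> (int r - 1) c) = - inner_cartan c (int p)"
          if "0 \<le> c" "c \<le> int d" for c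
          using \<sigma>_forms[of "int p" c r] \<sigma>_forms[of c "int p" r] that p
            form_skew[of "\<sigma> (int r) (int p)" "\<sigma> (int r - 1) c"] by auto
        have \<delta>: "?\<delta> (b + 1) + ?\<delta> (b - 1) - ?\<delta> b + inner_cartan b (int p) = ?\<delta> b"
          using True p by (auto simp: inner_cartan_def cartan_def)
        have "\<omega> (moved p (Suc r) v) (\<sigma> (int (Suc r)) b) =
            ?\<delta> (b + 1) + ?\<delta> (b - 1) - ?\<delta> b + inner_cartan b (int p)"
          using Suc.IH True unfolding mv rec
          by (simp add: form_add_left form_add_right form_diff_right \<sigma>)
        moreover have "\<omega> (moved p (Suc r) v) (\<sigma> (int (Suc r) - 1) b) = ?\<delta> b"
          using Suc.IH True unfolding mv by (simp add: form_add_left \<sigma>)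
        ultimately show ?thesis unfolding \<delta> by (rule conjI)
      next
        case False
        then have "\<forall>k. \<sigma> k b = 0" using b \<sigma>_boundary by (metis atLeastAtMost_iff order_le_less)
        then show ?thesis using False by (auto simp: form_zero_right)
      qed
    qed
  qed
  then show "\<omega> (moved p r v) (\<sigma> (int r) b) = ?\<delta> b" "\<omega> (moved p r v) (\<sigma> (int r - 1) b) = ?\<delta> b"
    using b by auto
qed

lemma sum_\<sigma>_delta:
  assumes "p < d"
  shows "(\<Sum>i\<in>{1..<d}. frag_cmul (if i = p then 1 else 0) (\<sigma> k (int i))) = \<sigma> k (int p)"
proof (cases "p = 0")
  case True
  then show ?thesis by (auto simp: \<sigma>_boundary intro!: sum.neutral)
next
  case False
  have "(\<Sum>i\<in>{1..<d}. frag_cmul (if i = p then 1 else 0) (\<sigma> k (int i)))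
      = (\<Sum>i\<in>{1..<d}. if i = p then \<sigma> k (int i) else 0)"
    by (intro sum.cong) auto
  then show ?thesis using False assms by simp
qed

lemma sum_\<sigma>_neighbours:
  assumes "0 < a" "a < d"
  shows "(\<Sum>i\<in>{1..<d}. frag_cmul (max 0 (- inner_cartan (int a) (int i))) (\<sigma> k (int i)))
    = \<sigma> k (int a + 1) + \<sigma> k (int a - 1)"
proof -
  have succ: "(if a + 1 = d then 0 else a + 1) < d" and prev: "a - 1 < d"
    using assms by auto
  have "(\<Sum>i\<in>{1..<d}. frag_cmul (max 0 (- inner_cartan (int a) (int i))) (\<sigma> k (int i)))
    = (\<Sum>i\<in>{1..<d}. frag_cmul (if i = (if a + 1 = d then 0 else a + 1) then 1 else 0) (\<sigma> k (int i)) +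
         frag_cmul (if i = a - 1 then 1 else 0) (\<sigma> k (int i)))"
    using assms by (intro sum.cong) (auto simp: inner_cartan_def cartan_def)
  also have "\<dots> = \<sigma> k (int (if a + 1 = d then 0 else a + 1)) + \<sigma> k (int (a - 1))"
    by (simp only: sum.distrib sum_\<sigma>_delta[OF succ] sum_\<sigma>_delta[OF prev])
  also have "\<sigma> k (int (if a + 1 = d then 0 else a + 1)) = \<sigma> k (int a + 1)"
    using \<sigma>_boundary[of k] by (auto simp: algebra_simps)
  finally show ?thesis using assms by (simp add: of_nat_diff)
qed

lemma reachable_rounds:
  assumes "reachable (image_mset s (mset_set {1..<d}) + image_mset t (mset_set {1..<d}) + R)"
    and q: "\<And>v. v \<in># R \<Longrightarrow> attached (q v) v"
    and "r \<le> d"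
  shows "reachable (image_mset (\<lambda>n. \<sigma> (int r) (int n)) (mset_set {1..<d}) +
      image_mset (\<lambda>n. - \<sigma> (int r - 1) (int n)) (mset_set {1..<d}) +
      image_mset (\<lambda>v. moved (q v) r v) R)"
  using assms(3)
proof (induction r)
  case 0
  have "image_mset (\<lambda>n. \<sigma> (int 0) (int n)) (mset_set {1..<d}) = image_mset s (mset_set {1..<d})"
    by (rule image_mset_cong) (auto simp: \<sigma>_start)
  moreover have "image_mset (\<lambda>n. - \<sigma> (int 0 - 1) (int n)) (mset_set {1..<d})
      = image_mset t (mset_set {1..<d})"
    by (rule image_mset_cong) (auto simp: \<sigma>_before)
  moreover have "image_mset (\<lambda>v. moved (q v) 0 v) R = R"
    by (simp add: moved_def)
  ultimately show ?case using assms(1) by simp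
next
  case (Suc r)
  let ?I = "mset_set {1..<d}"
  let ?f = "\<lambda>n. \<sigma> (int r) (int n)"
  let ?push = "\<lambda>v. v + (\<Sum>i\<in>{1..<d}. frag_cmul (max 0 (\<omega> v (?f i))) (?f i))"
  have "reachable (image_mset ?f ?I + (image_mset (\<lambda>n. - \<sigma> (int r - 1) (int n)) ?I +
      image_mset (\<lambda>v. moved (q v) r v) R))"
    using Suc by (simp add: add.assoc)
  then have "reachable (image_mset (\<lambda>n. - ?f n) ?I +
      image_mset ?push (image_mset (\<lambda>n. - \<sigma> (int r - 1) (int n)) ?I +
        image_mset (\<lambda>v. moved (q v) r v) R))"
    by (rule reachable_mutate_orthogonal[rotated])
      (use Suc.prems effective_\<sigma> \<sigma>_forms in auto)
  moreover have "image_mset ?push (image_mset (\<lambda>n. - \<sigma> (int r - 1) (int n)) ?I)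
      = image_mset (\<lambda>n. \<sigma> (int (Suc r)) (int n)) ?I"
    unfolding multiset.map_comp comp_def
  proof (rule image_mset_cong)
    fix n assume "n \<in># ?I"
    then have n: "0 < n" "n < d" by auto
    have "(\<Sum>i\<in>{1..<d}. frag_cmul (max 0 (\<omega> (- \<sigma> (int r - 1) (int n)) (?f i))) (?f i)) =
        (\<Sum>i\<in>{1..<d}. frag_cmul (max 0 (- inner_cartan (int n) (int i))) (?f i))"
      using n \<sigma>_forms by (intro sum.cong) (auto simp: form_uminus_left)
    then show "?push (- \<sigma> (int r - 1) (int n)) = \<sigma> (int (Suc r)) (int n)"
      using \<sigma>_recursion[of "int r" "int n"] sum_\<sigma>_neighbours[OF n, of "int r"]
      by (simp add: algebra_simps)
  qed
  moreover have "image_mset ?push (image_mset (\<lambda>v. moved (q v) r v) R)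
      = image_mset (\<lambda>v. moved (q v) (Suc r) v) R"
    unfolding multiset.map_comp comp_def
  proof (rule image_mset_cong)
    fix v assume "v \<in># R"
    note qv = q[OF this]
    have "(\<Sum>i\<in>{1..<d}. frag_cmul (max 0 (\<omega> (moved (q v) r v) (?f i))) (?f i)) =
        (\<Sum>i\<in>{1..<d}. frag_cmul (if i = q v then 1 else 0) (?f i))"
      using moved_forms(1)[OF qv] by (intro sum.cong) auto
    then show "?push (moved (q v) r v) = moved (q v) (Suc r) v"
      using sum_\<sigma>_delta[of "q v" "int r"] qv by (simp add: moved_def attached_def add.assoc)
  qed
  ultimately show ?case by (simp add: ac_simps)
qed

text \<open>
  After \<open>d\<close> rounds the wave has travelled to the other end of the chain and has been
  reflected with the opposite sign.
\<close>
theorem reachable_reverse_node: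
  assumes "reachable (image_mset s (mset_set {1..<d}) + image_mset t (mset_set {1..<d}) + R)"
    and q: "\<And>v. v \<in># R \<Longrightarrow> attached (q v) v \<and> q v \<in> {0, 1, d - 1}"
  shows "reachable (image_mset (\<lambda>n. - s n) (mset_set {1..<d}) +
      image_mset (\<lambda>n. - t n) (mset_set {1..<d}) +
      image_mset (\<lambda>v. if q v = 0 then v else v + (\<Sum>n\<in>{1..<d}. s n + t n)) R)"
proof -
  let ?I = "mset_set {1..<d}"
  have refl: "image_mset (\<lambda>n. f (d - n)) ?I = image_mset f ?I" for f :: "nat \<Rightarrow> 'b \<Rightarrow>\<^sub>0 int"
  proof -
    have "inj_on (\<lambda>n. d - n) {1..<d}" by (rule inj_onI) (simp, arith)
    moreover have "(\<lambda>n. d - n) ` {1..<d} = {1..<d}"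
    proof
      show "{1..<d} \<subseteq> (\<lambda>n. d - n) ` {1..<d}"
      proof
        fix n assume "n \<in> {1..<d}"
        then show "n \<in> (\<lambda>n. d - n) ` {1..<d}" by (intro image_eqI[of _ _ "d - n"]) auto
      qed
    qed auto
    ultimately have "image_mset (\<lambda>n. d - n) ?I = ?I" by (simp add: image_mset_mset_set)
    then have "image_mset f (image_mset (\<lambda>n. d - n) ?I) = image_mset f ?I" by simp
    then show ?thesis by (simp add: multiset.map_comp comp_def)
  qed
  have "image_mset (\<lambda>n. \<sigma> (int d) (int n)) ?I = image_mset (\<lambda>n. - s (d - n)) ?I"
    by (rule image_mset_cong) (auto simp: \<sigma>_end)
  then have s: "image_mset (\<lambda>n. \<sigma> (int d) (int n)) ?I = image_mset (\<lambda>n. - s n) ?I"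
    using refl[of "\<lambda>n. - s n"] by simp
  have "image_mset (\<lambda>n. - \<sigma> (int d - 1) (int n)) ?I = image_mset (\<lambda>n. - t (d - n)) ?I"
    by (rule image_mset_cong) (auto simp: \<sigma>_before_end)
  then have t: "image_mset (\<lambda>n. - \<sigma> (int d - 1) (int n)) ?I = image_mset (\<lambda>n. - t n) ?I"
    using refl[of "\<lambda>n. - t n"] by simp
  have "image_mset (\<lambda>v. moved (q v) d v) R =
      image_mset (\<lambda>v. if q v = 0 then v else v + (\<Sum>n\<in>{1..<d}. s n + t n)) R"
  proof (rule image_mset_cong)
    fix v assume "v \<in># R"
    from q[OF this] consider "q v = 0" | "q v = 1" | "q v = d - 1" "1 < d"
      using d_pos by fastforce
    then show "moved (q v) d v = (if q v = 0 then v else v + (\<Sum>n\<in>{1..<d}. s n + t n))"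
    proof cases
      case 1
      then show ?thesis by (simp add: moved_def \<sigma>_boundary)
    next
      case 2
      then show ?thesis using sum_\<sigma>_first by (simp add: moved_def)
    next
      case 3
      then show ?thesis using sum_\<sigma>_last by (simp add: moved_def of_nat_diff)
    qed
  qed
  then show ?thesis
    using reachable_rounds[OF assms(1), of q d] q s t by simp
qed

end

section \<open>Weights at the nodes of a quiver\<close>

locale loopfree_weighted_quiver = weighted_quiver \<Gamma> F d
  for \<Gamma> :: "('v, 'a) pre_digraph" and F d +
  fixes g :: nat and \<theta> :: "nat \<Rightarrow> 'a \<Rightarrow> int"
  assumes no_loop: "a \<in> arcs \<Gamma> \<Longrightarrow> tail \<Gamma> a \<noteq> head \<Gamma> a"
begin

abbreviation form :: "('v gen \<Rightarrow>\<^sub>0 int) \<Rightarrow> ('v gen \<Rightarrow>\<^sub>0 int) \<Rightarrow> int" where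
  "form \<equiv> quiver_form \<Gamma> F d"

abbreviation labels :: "('v, 'a) label set" where
  "labels \<equiv> seed_labels \<Gamma> F d"

abbreviation seed :: "('v, 'a) label \<Rightarrow> ('v gen \<Rightarrow>\<^sub>0 int)" where
  "seed \<equiv> seed_vector \<Gamma> F d g \<theta>"

lemma finite_seed_labels: "finite labels"
proof -
  have "labels = (\<lambda>(i, m). S i m) ` Sigma (verts \<Gamma> - F) (\<lambda>i. {1..<d i}) \<union>
      (\<lambda>(i, m). T i m) ` Sigma (verts \<Gamma> - F) (\<lambda>i. {1..<d i}) \<union> Arrow ` arcs \<Gamma>"
    by (auto simp: seed_labels_def image_iff)
  then show ?thesis by simp
qed

sublocale green_mutations form labels seed
proof
  show "finite labels" by (rule finite_seed_labels)
  show "form (u + v) w = form u w + form v w" for u v w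
    unfolding quiver_form_def
    by (simp add: lookup_add algebra_simps sum.distrib sum_subtractf)
  show "form u v = - form v u" for u v
    unfolding quiver_form_def by (simp add: sum_negf[symmetric] mult.commute)
qed

lemma dim_pos: "v \<in> verts \<Gamma> \<Longrightarrow> 1 \<le> d v"
  using gauge_dim flavor_dim by (cases "v \<in> F") auto

definition gauge_index :: "'v \<Rightarrow> nat \<Rightarrow> bool" where
  "gauge_index v m \<longleftrightarrow> v \<in> verts \<Gamma> - F \<and> 1 \<le> m \<and> m \<le> d v"

lemma sum_nodes_delta:
  "(\<Sum>j\<in>verts \<Gamma> - F. \<Sum>n=1..d j. if j = i \<and> n = m then f j n else 0) =
     (if gauge_index i m then f i m else (0::int))"
proof -
  have "(\<Sum>j\<in>verts \<Gamma> - F. \<Sum>n=1..d j. if j = i \<and> n = m then f j n else 0) =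
      (\<Sum>j\<in>verts \<Gamma> - F. if j = i then (\<Sum>n=1..d j. if n = m then f j n else 0) else 0)"
    by (intro sum.cong) auto
  also have "\<dots> = (if gauge_index i m then f i m else 0)"
    by (auto simp: sum.delta gauge_index_def)
  finally show ?thesis .
qed

lemma form_P: "form (frag_of (P i m)) w = (if gauge_index i m then Poly_Mapping.lookup w (X i m) else 0)"
proof -
  have "form (frag_of (P i m)) w = (\<Sum>j\<in>verts \<Gamma> - F. \<Sum>n=1..d j.
      if j = i \<and> n = m then Poly_Mapping.lookup w (X j n) else 0)"
    unfolding quiver_form_def by (intro sum.cong) auto
  then show ?thesis by (simp only: sum_nodes_delta)
qed

lemma form_X: "form (frag_of (X i m)) w = (if gauge_index i m then - Poly_Mapping.lookup w (P i m) else 0)"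
proof -
  have "form (frag_of (X i m)) w = (\<Sum>j\<in>verts \<Gamma> - F. \<Sum>n=1..d j.
      if j = i \<and> n = m then - Poly_Mapping.lookup w (P j n) else 0)"
    unfolding quiver_form_def by (intro sum.cong) auto
  then show ?thesis by (simp only: sum_nodes_delta)
qed

lemma form_Zeta: "form (frag_of (Zeta i)) w = 0"
  unfolding quiver_form_def by simp

lemma form_Upsilon: "form (frag_of (Upsilon r)) w = 0"
  unfolding quiver_form_def by simp

text \<open>
  A flavor node behaves like a gauge node of dimension one whose momentum is orthogonal to
  everything; with this convention all arrows have the same shape.
\<close>
definition momentum :: "'v \<Rightarrow> nat \<Rightarrow> 'v gen \<Rightarrow>\<^sub>0 int" where
  "momentum v m = (if v \<in> F then frag_of (Zeta v) else frag_of (P v m))"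

definition coord :: "'v \<Rightarrow> nat \<Rightarrow> 'v gen \<Rightarrow>\<^sub>0 int" where
  "coord v m = (if v \<in> F then 0 else frag_of (X v m))"

definition cycle_part :: "'a \<Rightarrow> 'v gen \<Rightarrow>\<^sub>0 int" where
  "cycle_part a = (if tail \<Gamma> a \<in> F \<or> head \<Gamma> a \<in> F then 0
     else \<Sum>r=1..g. frag_cmul (\<theta> r a) (frag_of (Upsilon r)))"

lemma form_cyc: "form (cycle_part a) w = 0" "form w (cycle_part a) = 0"
proof -
  show "form (cycle_part a) w = 0"
    by (simp add: cycle_part_def form_zero_left form_sum_left form_cmul_left form_Upsilon)
  then show "form w (cycle_part a) = 0" using form_skew[of w "cycle_part a"] by simp
qed

lemma form_mom_mom: "form (momentum v m) (momentum v' m') = 0"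
  by (simp add: momentum_def form_P form_Zeta)

lemma form_pos_pos: "form (coord v m) (coord v' m') = 0"
  by (simp add: coord_def form_X form_zero_left)

lemma form_mom_pos:
  "form (momentum v m) (coord v' m') = (if gauge_index v m \<and> v = v' \<and> m = m' then 1 else 0)"
  by (auto simp: momentum_def coord_def form_P form_Zeta gauge_index_def)

lemma form_pos_mom:
  "form (coord v m) (momentum v' m') = (if gauge_index v m \<and> v = v' \<and> m = m' then - 1 else 0)"
  by (auto simp: momentum_def coord_def form_X form_zero_left gauge_index_def)

lemmas form_eval = form_add_left form_add_right form_diff_left form_diff_right
  form_uminus_left form_uminus_right form_cyc
  form_mom_mom form_pos_pos form_mom_pos form_pos_mom

definition s_vector :: "'v \<Rightarrow> nat \<Rightarrow> 'v gen \<Rightarrow>\<^sub>0 int" where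
  "s_vector v m = coord v (m + 1) - coord v m"

definition t_vector :: "'v \<Rightarrow> nat \<Rightarrow> 'v gen \<Rightarrow>\<^sub>0 int" where
  "t_vector v m = momentum v m - momentum v (m + 1) + coord v m - coord v (m + 1)"

lemma seed_S: "v \<notin> F \<Longrightarrow> seed (S v m) = s_vector v m"
  by (simp add: s_vector_def coord_def)

lemma seed_T: "v \<notin> F \<Longrightarrow> seed (T v m) = t_vector v m"
  by (simp add: t_vector_def coord_def momentum_def)

lemma seed_Arrow:
  "a \<in> arcs \<Gamma> \<Longrightarrow> seed (Arrow a) = momentum (head \<Gamma> a) (d (head \<Gamma> a)) - momentum (tail \<Gamma> a) 1 + cycle_part a"
  using no_flavor_flavor[of a] by (auto simp: momentum_def cycle_part_def Let_def)

lemma toda: 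
  assumes "v \<in> verts \<Gamma>"
  shows "toda_node form labels seed (s_vector v) (t_vector v) (d v)"
proof
  show "1 \<le> d v" by (rule dim_pos[OF assms])
  have in_F: "v \<notin> F" if "0 < a" "a < d v" for a
    using that flavor_dim[of v] by auto
  fix a assume a: "0 < a" "a < d v"
  have "S v a \<in> labels" "T v a \<in> labels"
    using a in_F[OF a] assms by (auto simp: seed_labels_def)
  then show "effective (s_vector v a)" "effective (t_vector v a)"
    using effective_seed seed_S[OF in_F[OF a]] seed_T[OF in_F[OF a]] by metis+
  fix b assume b: "0 < b" "b < d v"
  have i: "gauge_index v a" "gauge_index v (Suc a)" "gauge_index v b" "gauge_index v (Suc b)"
    using a b in_F[OF a] assms by (auto simp: gauge_index_def)
  show "form (s_vector v a) (s_vector v b) = 0" by (simp add: s_vector_def form_eval)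
  show "form (t_vector v a) (t_vector v b) = 0"
    by (simp add: t_vector_def form_eval i)
  show "form (s_vector v a) (t_vector v b) = cartan (int a) (int b)"
    by (auto simp add: s_vector_def t_vector_def form_eval i cartan_def)
qed

text \<open>
  At a node of dimension \<open>d\<close>, both chains run through \<open>2 * (d - 1) + 1\<close> weights.
  The one used at the head of an arrow leads from \<open>p\<^sub>d\<close> down to \<open>p\<^sub>1\<close>, the one
  used at the tail from \<open>p\<^sub>1\<close> up to \<open>p\<^sub>d\<close>. The half-step between consecutive
  momenta is fixed by the requirement that the increments of the first chain and the decrements of
  the second are alternately the vectors \<open>t\<close> and \<open>s\<close>.
\<close>
definition head_chain :: "'v \<Rightarrow> nat \<Rightarrow> 'v gen \<Rightarrow>\<^sub>0 int" where
  "head_chain v k = (let n = d v - k div 2 in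
     if even k then momentum v n else momentum v (n - 1) + coord v (n - 1) - coord v n)"

definition tail_chain :: "'v \<Rightarrow> nat \<Rightarrow> 'v gen \<Rightarrow>\<^sub>0 int" where
  "tail_chain v l = (let n = l div 2 + 1 in
     if even l then momentum v n else momentum v (n + 1) + coord v (n + 1) - coord v n)"

abbreviation chain_length :: "'v \<Rightarrow> nat" where
  "chain_length v \<equiv> 2 * (d v - 1)"

lemma chain_form_parity:
  "chain_form (2 * q) (2 * q') = 0"
  "chain_form (2 * q) (2 * q' + 1) = (if q = q' + 1 then 1 else 0) - (if q = q' then 1 else 0)"
  "chain_form (2 * q + 1) (2 * q') = (if q = q' then 1 else 0) - (if q' = q + 1 then 1 else 0)"
  "chain_form (2 * q + 1) (2 * q' + 1) = (if q = q' + 1 then 1 else 0) - (if q' = q + 1 then 1 else 0)"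
proof -
  have "2 * q \<noteq> 2 * q' + 1" "2 * q' \<noteq> 2 * q + 1" by presburger+
  then show "chain_form (2 * q) (2 * q') = 0" by (simp add: chain_form_def)
qed (simp_all add: chain_form_def)

lemma parity_cases:
  fixes k :: nat
  obtains q where "k = 2 * q" | q where "k = 2 * q + 1"
  by (metis evenE oddE)

lemma head_chain_even: "head_chain v (2 * q) = momentum v (d v - q)"
  by (simp add: head_chain_def)

lemma head_chain_odd:
  "head_chain v (2 * q + 1) = momentum v (d v - q - 1) + coord v (d v - q - 1) - coord v (d v - q)"
  by (simp add: head_chain_def)

lemma tail_chain_even: "tail_chain v (2 * q) = momentum v (q + 1)"
  by (simp add: tail_chain_def)

lemma tail_chain_odd: "tail_chain v (2 * q + 1) = momentum v (q + 2) + coord v (q + 2) - coord v (q + 1)"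
  by (simp add: tail_chain_def)

lemmas chain_parity = head_chain_even head_chain_odd tail_chain_even tail_chain_odd

lemma form_head_chain:
  assumes "v \<in> verts \<Gamma>" "k \<le> chain_length v" "k' \<le> chain_length v"
  shows "form (head_chain v k) (head_chain v k') = chain_form k k'"
proof (cases "v \<in> F")
  case True
  then have "k = 0" "k' = 0" using assms flavor_dim by auto
  then show ?thesis by (simp add: head_chain_def chain_form_def form_mom_mom)
next
  case False
  have i: "gauge_index v m \<longleftrightarrow> 1 \<le> m \<and> m \<le> d v" for m using False assms(1) by (simp add: gauge_index_def)
  note d = dim_pos[OF assms(1)]
  show ?thesis
  proof (cases k rule: parity_cases; cases k' rule: parity_cases)
    fix q q' assume k: "k = 2 * q" "k' = 2 * q'"
    show ?thesis unfolding k chain_parity chain_form_parity form_eval ..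
  next
    fix q q' assume k: "k = 2 * q" "k' = 2 * q' + 1"
    have "q < d v" "q' + 1 < d v" using assms(2,3) d unfolding k by arith+
    then have "1 \<le> d v - q" "d v - q \<le> d v" "d v - q = d v - q' - 1 \<longleftrightarrow> q = q' + 1" "d v - q = d v - q' \<longleftrightarrow> q = q'"
      by arith+
    then show ?thesis unfolding k chain_parity chain_form_parity form_eval i by simp
  next
    fix q q' assume k: "k = 2 * q + 1" "k' = 2 * q'"
    have "q + 1 < d v" "q' < d v" using assms(2,3) d unfolding k by arith+
    then have "1 \<le> d v - q" "d v - q \<le> d v" "1 \<le> d v - q - 1" "d v - q - 1 \<le> d v"
      "d v - q - 1 = d v - q' \<longleftrightarrow> q' = q + 1" "d v - q = d v - q' \<longleftrightarrow> q = q'"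
      by arith+
    then show ?thesis unfolding k chain_parity chain_form_parity form_eval i by simp
  next
    fix q q' assume k: "k = 2 * q + 1" "k' = 2 * q' + 1"
    have "q + 1 < d v" "q' + 1 < d v" using assms(2,3) d unfolding k by arith+
    then have "1 \<le> d v - q" "d v - q \<le> d v" "1 \<le> d v - q - 1" "d v - q - 1 \<le> d v"
      "d v - q - 1 = d v - q' \<longleftrightarrow> q' = q + 1" "d v - q = d v - q' - 1 \<longleftrightarrow> q = q' + 1"
      "d v - q - 1 = d v - q' - 1 \<longleftrightarrow> q = q'" 
      by arith+
    then show ?thesis unfolding k chain_parity chain_form_parity form_eval i by simp
  qed
qed

lemma form_tail_chain:
  assumes "v \<in> verts \<Gamma>" "k \<le> chain_length v" "k' \<le> chain_length v"
  shows "form (tail_chain v k) (tail_chain v k') = chain_form k k'"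
proof (cases "v \<in> F")
  case True
  then have "k = 0" "k' = 0" using assms flavor_dim by auto
  then show ?thesis by (simp add: tail_chain_def chain_form_def form_mom_mom)
next
  case False
  have i: "gauge_index v m \<longleftrightarrow> 1 \<le> m \<and> m \<le> d v" for m using False assms(1) by (simp add: gauge_index_def)
  note d = dim_pos[OF assms(1)]
  show ?thesis
  proof (cases k rule: parity_cases; cases k' rule: parity_cases)
    fix q q' assume k: "k = 2 * q" "k' = 2 * q'"
    show ?thesis unfolding k chain_parity chain_form_parity form_eval ..
  next
    fix q q' assume k: "k = 2 * q" "k' = 2 * q' + 1"
    have "q < d v" "q' + 1 < d v" using assms(2,3) d unfolding k by arith+
    then show ?thesis unfolding k chain_parity chain_form_parity form_eval i by simp
  next
    fix q q' assume k: "k = 2 * q + 1" "k' = 2 * q'"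
    have "q + 1 < d v" "q' < d v" using assms(2,3) d unfolding k by arith+
    then show ?thesis unfolding k chain_parity chain_form_parity form_eval i by simp
  next
    fix q q' assume k: "k = 2 * q + 1" "k' = 2 * q' + 1"
    have "q + 1 < d v" "q' + 1 < d v" using assms(2,3) d unfolding k by arith+
    then show ?thesis unfolding k chain_parity chain_form_parity form_eval i by simp
  qed
qed

lemma form_chain_distinct:
  assumes "v \<noteq> v'"
  shows "form (momentum v m) (head_chain v' k) = 0" "form (momentum v m) (tail_chain v' k) = 0"
    "form (coord v m) (head_chain v' k) = 0" "form (coord v m) (tail_chain v' k) = 0"
    "form (tail_chain v l) (head_chain v' k) = 0"
  using assms by (simp_all add: head_chain_def tail_chain_def form_eval Let_def)

lemma mom_eq_chain_end:
  assumes "v \<in> verts \<Gamma>"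
  shows "momentum v (d v) = head_chain v 0" "momentum v 1 = head_chain v (chain_length v)"
    "momentum v 1 = tail_chain v 0" "momentum v (d v) = tail_chain v (chain_length v)"
  using dim_pos[OF assms] head_chain_even[of v 0] head_chain_even[of v "d v - 1"]
    tail_chain_even[of v 0] tail_chain_even[of v "d v - 1"] by simp_all

text \<open>
  The momenta \<open>p\<^sub>d\<close> and \<open>p\<^sub>1\<close>, through which arrows are attached to a node, are the
  ends of the chains, and the pairing of an end of a chain with the other weights has a constant
  sign.
\<close>
lemma form_mom_ends:
  assumes "v \<in> verts \<Gamma>" "w \<in> verts \<Gamma>" "k \<le> chain_length w"
  shows "form (momentum v (d v)) (head_chain w k) \<le> 0" "form (momentum v 1) (head_chain w k) \<ge> 0"
    "form (momentum v (d v)) (tail_chain w k) \<ge> 0" "form (momentum v 1) (tail_chain w k) \<le> 0"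
proof -
  show "form (momentum v (d v)) (head_chain w k) \<le> 0"
    using form_chain_distinct[of v w] form_head_chain[OF assms(2), of 0 k] assms(3)
      mom_eq_chain_end(1)[OF assms(2)] by (cases "v = w") (auto simp: chain_form_def)
  show "form (momentum v 1) (head_chain w k) \<ge> 0"
    using form_chain_distinct[of v w] form_head_chain[OF assms(2), of "chain_length w" k] assms(3)
      mom_eq_chain_end(2)[OF assms(2)] by (cases "v = w") (auto simp: chain_form_def)
  show "form (momentum v (d v)) (tail_chain w k) \<ge> 0"
    using form_chain_distinct[of v w] form_tail_chain[OF assms(2), of "chain_length w" k] assms(3)
      mom_eq_chain_end(4)[OF assms(2)] by (cases "v = w") (auto simp: chain_form_def)
  show "form (momentum v 1) (tail_chain w k) \<le> 0"
    using form_chain_distinct[of v w] form_tail_chain[OF assms(2), of 0 k] assms(3)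
      mom_eq_chain_end(3)[OF assms(2)] by (cases "v = w") (auto simp: chain_form_def)
qed

lemma head_chain_step:
  assumes "k < chain_length v"
  shows "head_chain v (k + 1) - head_chain v k =
    (if even k then t_vector v (d v - k div 2 - 1) else s_vector v (d v - k div 2 - 1))"
proof (cases k rule: parity_cases)
  case (1 q)
  have "d v - q = Suc (d v - q - 1)" using assms 1 by arith
  then show ?thesis using head_chain_even[of v q] head_chain_odd[of v q] 1
    by (simp add: t_vector_def)
next
  case (2 q)
  have "d v - q = Suc (d v - q - 1)" using assms 2 by arith
  then show ?thesis using head_chain_even[of v "q + 1"] head_chain_odd[of v q] 2
    by (simp add: s_vector_def)
qed

lemma tail_chain_step:
  "tail_chain v l - tail_chain v (l + 1) =
    (if even l then t_vector v (l div 2 + 1) else s_vector v (l div 2 + 1))"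
proof (cases l rule: parity_cases)
  case (1 q)
  then show ?thesis using tail_chain_even[of v q] tail_chain_odd[of v q]
    by (simp add: t_vector_def)
next
  case (2 q)
  then show ?thesis using tail_chain_even[of v "q + 1"] tail_chain_odd[of v q]
    by (simp add: s_vector_def)
qed

end

section \<open>Reversing the arrows\<close>

lemma diffs_append_nonempty:
  assumes "us \<noteq> []" "vs \<noteq> []"
  shows "diffs (us @ vs) = add_mset (hd vs - last us) (diffs us + diffs vs)"
proof -
  have eq: "us @ vs = butlast us @ last us # vs"
    using assms(1) by (metis append_butlast_last_id append.assoc append_Cons append_Nil)
  show ?thesis
    unfolding eq using diffs_append[of "butlast us" "last us" vs] assms by (simp add: diffs_Cons)
qed

lemma diffs_map_upt:
  "diffs (map f [0..<Suc n]) = image_mset (\<lambda>k. f (k + 1) - f k) (mset_set {..<n})"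
proof (induction n)
  case (Suc n)
  have "diffs (map f [0..<Suc (Suc n)]) = diffs (map f [0..<Suc n] @ [f (Suc n)])" by simp
  also have "\<dots> = add_mset (f (Suc n) - last (map f [0..<Suc n])) (diffs (map f [0..<Suc n]))"
    by (rule diffs_snoc) simp
  finally show ?case using Suc.IH by (simp add: lessThan_Suc)
qed simp

lemma diffs_map_rev_upt:
  "diffs (map f (rev [0..<Suc n])) = image_mset (\<lambda>k. f k - f (k + 1)) (mset_set {..<n})"
proof (induction n)
  case (Suc n)
  have "diffs (map f (rev [0..<Suc (Suc n)])) = diffs (f (Suc n) # map f (rev [0..<Suc n]))" by simp
  also have "\<dots> = add_mset (hd (map f (rev [0..<Suc n])) - f (Suc n)) (diffs (map f (rev [0..<Suc n])))"
    by (rule diffs_Cons) simp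
  finally show ?case using Suc.IH by (simp add: lessThan_Suc)
qed simp

lemma image_mset_even_odd:
  fixes n :: nat
  shows "image_mset f (mset_set {..<2 * n}) =
     image_mset (\<lambda>q. f (2 * q)) (mset_set {..<n}) + image_mset (\<lambda>q. f (2 * q + 1)) (mset_set {..<n})"
  by (induction n) (simp_all add: lessThan_Suc)

lemma image_mset_reindex:
  assumes "bij_betw h I J"
  shows "image_mset (\<lambda>i. f (h i)) (mset_set I) = image_mset f (mset_set J)"
proof -
  have "image_mset f (mset_set J) = image_mset f (image_mset h (mset_set I))"
    using assms by (simp add: bij_betw_def image_mset_mset_set)
  then show ?thesis by (simp add: multiset.map_comp comp_def)
qed

context loopfree_weighted_quiver
begin

definition node :: "'v \<Rightarrow> ('v gen \<Rightarrow>\<^sub>0 int) multiset" where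
  "node v = image_mset (s_vector v) (mset_set {1..<d v}) + image_mset (t_vector v) (mset_set {1..<d v})"

lemma head_chain_node:
  "image_mset (\<lambda>k. head_chain v (k + 1) - head_chain v k) (mset_set {..<chain_length v}) = node v"
proof -
  have bij: "bij_betw (\<lambda>q. d v - q - 1) {..<d v - 1} {1..<d v}"
    by (rule bij_betw_byWitness[of _ "\<lambda>n. d v - n - 1"]) auto
  have "image_mset (\<lambda>k. head_chain v (k + 1) - head_chain v k) (mset_set {..<chain_length v}) =
    image_mset (\<lambda>k. if even k then t_vector v (d v - k div 2 - 1) else s_vector v (d v - k div 2 - 1))
      (mset_set {..<chain_length v})"
    by (rule image_mset_cong) (use head_chain_step in auto)
  also have "\<dots> = image_mset (\<lambda>q. t_vector v (d v - q - 1)) (mset_set {..<d v - 1}) +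
      image_mset (\<lambda>q. s_vector v (d v - q - 1)) (mset_set {..<d v - 1})"
    by (simp only: image_mset_even_odd) simp
  also have "\<dots> = node v"
    by (simp only: image_mset_reindex[OF bij] node_def add.commute)
  finally show ?thesis .
qed

lemma tail_chain_node:
  "image_mset (\<lambda>k. tail_chain v k - tail_chain v (k + 1)) (mset_set {..<chain_length v}) = node v"
proof -
  have bij: "bij_betw (\<lambda>q. q + 1) {..<d v - 1} {1..<d v}"
    by (rule bij_betw_byWitness[of _ "\<lambda>n. n - 1"]) auto
  have "image_mset (\<lambda>k. tail_chain v k - tail_chain v (k + 1)) (mset_set {..<chain_length v}) =
    image_mset (\<lambda>q. t_vector v (q + 1)) (mset_set {..<d v - 1}) +
      image_mset (\<lambda>q. s_vector v (q + 1)) (mset_set {..<d v - 1})"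
    by (simp only: image_mset_even_odd tail_chain_step) simp
  also have "\<dots> = node v"
    by (simp only: image_mset_reindex[OF bij] node_def add.commute)
  finally show ?thesis .
qed

text \<open>
  The sum runs over all vertices because flavor nodes have dimension one and contribute nothing.
\<close>
lemma seed_mset:
  fixes f :: "('v, 'a) label \<Rightarrow> 'c"
  shows "image_mset f (mset_set labels) =
     (\<Sum>v\<in>verts \<Gamma>. image_mset (\<lambda>m. f (S v m)) (mset_set {1..<d v}) +
        image_mset (\<lambda>m. f (T v m)) (mset_set {1..<d v})) +
     image_mset (\<lambda>a. f (Arrow a)) (mset_set (arcs \<Gamma>))"
proof -
  have single: "image_mset h (mset_set I) = (\<Sum>i\<in>I. {#h i#})" if "finite I"
    for h :: "'i \<Rightarrow> 'c" and I
    using that by (induction I) auto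
  let ?B = "Sigma (verts \<Gamma>) (\<lambda>v. {1..<d v})"
  have gauge: "(\<Sum>v\<in>verts \<Gamma> - F. h v) = (\<Sum>v\<in>verts \<Gamma>. h v)"
    if "\<And>v. d v = 1 \<Longrightarrow> h v = {#}" for h :: "'v \<Rightarrow> 'c multiset"
    using that flavor_dim by (intro sum.mono_neutral_left) auto
  have labels: "labels = (\<lambda>(v, m). S v m) ` ?B \<union> (\<lambda>(v, m). T v m) ` ?B \<union> Arrow ` arcs \<Gamma>"
    using flavor_dim by (fastforce simp: seed_labels_def image_iff)
  have fin: "finite ?B" by simp
  have "(\<Sum>l\<in>labels. {#f l#}) = (\<Sum>l\<in>(\<lambda>(v, m). S v m) ` ?B. {#f l#}) +
      (\<Sum>l\<in>(\<lambda>(v, m). T v m) ` ?B. {#f l#}) + (\<Sum>l\<in>Arrow ` arcs \<Gamma>. {#f l#})"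
    unfolding labels using fin by (subst sum.union_disjoint; (subst sum.union_disjoint)?; auto)
  also have "(\<Sum>l\<in>(\<lambda>(v, m). S v m) ` ?B. {#f l#}) = (\<Sum>v\<in>verts \<Gamma>. \<Sum>m\<in>{1..<d v}. {#f (S v m)#})"
    by (subst sum.reindex) (auto simp: inj_on_def sum.Sigma case_prod_unfold)
  also have "(\<Sum>l\<in>(\<lambda>(v, m). T v m) ` ?B. {#f l#}) = (\<Sum>v\<in>verts \<Gamma>. \<Sum>m\<in>{1..<d v}. {#f (T v m)#})"
    by (subst sum.reindex) (auto simp: inj_on_def sum.Sigma case_prod_unfold)
  also have "(\<Sum>l\<in>Arrow ` arcs \<Gamma>. {#f l#}) = (\<Sum>a\<in>arcs \<Gamma>. {#f (Arrow a)#})"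
    by (subst sum.reindex) (auto simp: inj_on_def)
  finally show ?thesis
    by (simp add: single finite_seed_labels sum.distrib)
qed

definition arrow :: "'a \<Rightarrow> 'v gen \<Rightarrow>\<^sub>0 int" where
  "arrow a = momentum (head \<Gamma> a) (d (head \<Gamma> a)) - momentum (tail \<Gamma> a) 1 + cycle_part a"

text \<open>
  The vector of an arrow after the first stage, when the Toda chains at the nodes in \<open>U\<close>
  have already been negated.
\<close>
definition reversed_arrow :: "'v set \<Rightarrow> 'a \<Rightarrow> 'v gen \<Rightarrow>\<^sub>0 int" where
  "reversed_arrow U a = momentum (tail \<Gamma> a) (if tail \<Gamma> a \<in> U then 1 else d (tail \<Gamma> a))
     - momentum (head \<Gamma> a) (if head \<Gamma> a \<in> U then d (head \<Gamma> a) else 1) - cycle_part a"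

lemma seed_mset_start:
  "image_mset seed (mset_set labels) = (\<Sum>v\<in>verts \<Gamma>. node v) + image_mset arrow (mset_set (arcs \<Gamma>))"
proof -
  have "image_mset (\<lambda>m. seed (S v m)) (mset_set {1..<d v}) +
      image_mset (\<lambda>m. seed (T v m)) (mset_set {1..<d v}) = node v" if "v \<in> verts \<Gamma>" for v
    using flavor_dim seed_S seed_T by (cases "v \<in> F") (simp_all add: node_def del: seed_vector.simps)
  moreover have "image_mset (\<lambda>a. seed (Arrow a)) (mset_set (arcs \<Gamma>)) = image_mset arrow (mset_set (arcs \<Gamma>))"
    by (rule image_mset_cong) (use seed_Arrow in \<open>auto simp: arrow_def simp del: seed_vector.simps\<close>)
  ultimately show ?thesis unfolding seed_mset by simp
qed

lemma effective_arrow: "a \<in> arcs \<Gamma> \<Longrightarrow> effective (arrow a)"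
  using effective_seed[of "Arrow a"] seed_Arrow[of a]
  by (simp add: arrow_def seed_labels_def del: seed_vector.simps)

lemma effective_head_chain:
  assumes "v \<in> verts \<Gamma>" "k \<le> chain_length v"
  shows "effective (head_chain v k - head_chain v 0)"
  using assms(2)
proof (induction k)
  case (Suc k)
  interpret toda_node form labels seed "s_vector v" "t_vector v" "d v" by (rule toda[OF assms(1)])
  have "effective (head_chain v (k + 1) - head_chain v k)"
    using head_chain_step[of k v] Suc.prems by (auto intro!: effective_s effective_t)
  from effective_add[OF this Suc.IH] Suc.prems show ?case by simp
qed (simp add: effective_zero)

lemma effective_tail_chain:
  assumes "v \<in> verts \<Gamma>" "l \<le> chain_length v"
  shows "effective (tail_chain v 0 - tail_chain v l)"
  using assms(2)
proof (induction l)
  case (Suc l)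
  interpret toda_node form labels seed "s_vector v" "t_vector v" "d v" by (rule toda[OF assms(1)])
  have "effective (tail_chain v l - tail_chain v (l + 1))"
    using tail_chain_step[of v l] Suc.prems by (auto intro!: effective_s effective_t)
  from effective_add[OF Suc.IH this] Suc.prems show ?case by simp
qed (simp add: effective_zero)

text \<open>
  The list of weights is the tail chain, read backwards, followed by the head chain, shifted by
  \<open>\<upsilon>(a)\<close>. Initially \<open>p\<^sub>i\<^sub>,\<^sub>1\<close> is followed by
  \<open>p\<^sub>j\<^sub>,\<^sub>d\<close>, and finally \<open>p\<^sub>j\<^sub>,\<^sub>1\<close> is followed by
  \<open>p\<^sub>i\<^sub>,\<^sub>d\<close>; all other differences are the same before and after.
\<close>
lemma reachable_reverse_arrow:
  assumes "a \<in> arcs \<Gamma>" "D \<subseteq> arcs \<Gamma>" "C \<subseteq> arcs \<Gamma>"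
    and "reachable ((\<Sum>v\<in>verts \<Gamma>. node v) + {#arrow a#} +
      (image_mset arrow (mset_set D) + image_mset (reversed_arrow {}) (mset_set C)))"
  shows "reachable ((\<Sum>v\<in>verts \<Gamma>. node v) + {#reversed_arrow {} a#} +
      (image_mset arrow (mset_set D) + image_mset (reversed_arrow {}) (mset_set C)))"
proof -
  let ?i = "tail \<Gamma> a" and ?j = "head \<Gamma> a"
  let ?\<alpha> = "\<lambda>k. head_chain ?j k + cycle_part a" and ?\<beta> = "tail_chain ?i"
  let ?E = "image_mset arrow (mset_set D) + image_mset (reversed_arrow {}) (mset_set C)"
  define N where "N = (\<Sum>v\<in>verts \<Gamma> - {?i, ?j}. node v)"
  have ij: "?i \<in> verts \<Gamma>" "?j \<in> verts \<Gamma>" "?i \<noteq> ?j" using assms(1) no_loop by auto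
  have nodes: "(\<Sum>v\<in>verts \<Gamma>. node v) = N + node ?i + node ?j"
  proof -
    have "(\<Sum>v\<in>verts \<Gamma>. node v) = (\<Sum>v\<in>verts \<Gamma> - {?i, ?j}. node v) + (\<Sum>v\<in>{?i, ?j}. node v)"
      using ij by (intro sum.subset_diff) auto
    then show ?thesis using ij(3) by (simp add: N_def add.assoc)
  qed
  have fin: "finite D" "finite C" using assms(2,3) by (simp_all add: finite_subset[OF _ finite_arcs])
  interpret crossing_chains form labels seed ?\<alpha> ?\<beta> "chain_length ?j" "chain_length ?i" "N + ?E"
  proof
    fix k k' assume "k \<le> chain_length ?j" "k' \<le> chain_length ?j"
    then show "form (?\<alpha> k) (?\<alpha> k') = chain_form k k'"
      using form_head_chain[OF ij(2)] by (simp add: form_add_left form_add_right form_cyc)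
  next
    fix l l' assume "l \<le> chain_length ?i" "l' \<le> chain_length ?i"
    then show "form (?\<beta> l) (?\<beta> l') = chain_form l l'" by (rule form_tail_chain[OF ij(1)])
  next
    fix k l assume k: "k \<le> chain_length ?j" and l: "l \<le> chain_length ?i"
    show "form (?\<beta> l) (?\<alpha> k) = 0"
      using form_chain_distinct(5)[OF ij(3)] by (simp add: form_add_right form_cyc)
    have split: "?\<alpha> k - ?\<beta> l = (head_chain ?j k - head_chain ?j 0) + (?\<beta> 0 - ?\<beta> l) + arrow a"
      using mom_eq_chain_end[OF ij(1)] mom_eq_chain_end[OF ij(2)] by (simp add: arrow_def)
    show "effective (?\<alpha> k - ?\<beta> l)"
      unfolding split
      by (intro effective_add effective_head_chain[OF ij(2) k] effective_tail_chain[OF ij(1) l]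
          effective_arrow[OF assms(1)])
    fix v assume "v \<in># N + ?E"
    then consider w where "w \<in> verts \<Gamma> - {?i, ?j}" "v \<in># node w"
      | b where "b \<in> arcs \<Gamma>" "v = arrow b" | b where "b \<in> arcs \<Gamma>" "v = reversed_arrow {} b"
      using fin assms(2,3) by (auto simp: N_def set_mset_sum)
    then show "form v (?\<alpha> k - ?\<beta> l) \<le> 0"
    proof cases
      case 1
      then have "form (momentum w m) (?\<alpha> k - ?\<beta> l) = 0" "form (coord w m) (?\<alpha> k - ?\<beta> l) = 0" for m
        using form_chain_distinct[of w ?i] form_chain_distinct[of w ?j]
        by (simp_all add: form_add_right form_diff_right form_cyc)
      then show ?thesis
        using 1(2) by (auto simp: node_def s_vector_def t_vector_def form_add_left form_diff_left)
    next
      case 2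
      have "head \<Gamma> b \<in> verts \<Gamma>" "tail \<Gamma> b \<in> verts \<Gamma>" using 2 by auto
      from form_mom_ends[OF this(1) ij(2) k] form_mom_ends[OF this(2) ij(2) k]
        form_mom_ends[OF this(1) ij(1) l] form_mom_ends[OF this(2) ij(1) l]
      show ?thesis unfolding 2(2) arrow_def
        by (simp add: form_add_left form_diff_left form_add_right form_diff_right form_cyc)
    next
      case 3
      have "head \<Gamma> b \<in> verts \<Gamma>" "tail \<Gamma> b \<in> verts \<Gamma>" using 3 by auto
      from form_mom_ends[OF this(1) ij(2) k] form_mom_ends[OF this(2) ij(2) k]
        form_mom_ends[OF this(1) ij(1) l] form_mom_ends[OF this(2) ij(1) l]
      show ?thesis unfolding 3(2) reversed_arrow_def
        by (simp add: form_add_left form_diff_left form_add_right form_diff_right form_cyc)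
    qed
  qed
  have \<alpha>: "diffs (map ?\<alpha> [0..<Suc (chain_length ?j)]) = node ?j"
    unfolding diffs_map_upt using head_chain_node by simp
  have \<beta>: "diffs (map ?\<beta> (rev [0..<Suc (chain_length ?i)])) = node ?i"
    unfolding diffs_map_rev_upt using tail_chain_node by simp
  have hd: "hd (map f [0..<Suc n]) = f 0" "last (map f [0..<Suc n]) = f n"
    "hd (map f (rev [0..<Suc n])) = f n" "last (map f (rev [0..<Suc n])) = f 0"
    for f :: "nat \<Rightarrow> 'v gen \<Rightarrow>\<^sub>0 int" and n
    by (simp_all add: hd_map last_map hd_rev last_rev hd_append del: upt_Suc)
  have "diffs (map ?\<beta> (rev [0..<Suc (chain_length ?i)]) @ map ?\<alpha> [0..<Suc (chain_length ?j)]) =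
      add_mset (?\<alpha> 0 - ?\<beta> 0) (node ?i + node ?j)"
    by (subst diffs_append_nonempty) (simp_all only: \<alpha> \<beta> hd, simp_all)
  moreover have "?\<alpha> 0 - ?\<beta> 0 = arrow a"
    using mom_eq_chain_end[OF ij(1)] mom_eq_chain_end[OF ij(2)] by (simp add: arrow_def)
  ultimately have "reachable (N + ?E +
      diffs (map ?\<beta> (rev [0..<Suc (chain_length ?i)]) @ map ?\<alpha> [0..<Suc (chain_length ?j)]))"
    using assms(4) nodes by (simp add: ac_simps)
  then have "reachable (N + ?E +
      diffs (map ?\<alpha> [0..<Suc (chain_length ?j)] @ map ?\<beta> (rev [0..<Suc (chain_length ?i)])))"
    by (rule reachable_cross)
  moreover have "diffs (map ?\<alpha> [0..<Suc (chain_length ?j)] @ map ?\<beta> (rev [0..<Suc (chain_length ?i)])) =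
      add_mset (?\<beta> (chain_length ?i) - ?\<alpha> (chain_length ?j)) (node ?j + node ?i)"
    by (subst diffs_append_nonempty) (simp_all only: \<alpha> \<beta> hd, simp_all)
  moreover have "?\<beta> (chain_length ?i) - ?\<alpha> (chain_length ?j) = reversed_arrow {} a"
    using mom_eq_chain_end[OF ij(1)] mom_eq_chain_end[OF ij(2)] by (simp add: reversed_arrow_def)
  ultimately show ?thesis using nodes by (simp add: ac_simps)
qed

lemma reachable_reverse_arrows:
  "reachable ((\<Sum>v\<in>verts \<Gamma>. node v) + image_mset (reversed_arrow {}) (mset_set (arcs \<Gamma>)))"
proof -
  have "reachable ((\<Sum>v\<in>verts \<Gamma>. node v) + (image_mset arrow (mset_set (arcs \<Gamma> - C)) +
      image_mset (reversed_arrow {}) (mset_set C)))" if "C \<subseteq> arcs \<Gamma>" for C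
    using finite_subset[OF that finite_arcs] that
  proof (induction C rule: finite_induct)
    case empty
    then show ?case using reachable_start by (simp add: seed_mset_start)
  next
    case (insert a C)
    have "mset_set (arcs \<Gamma> - C) = add_mset a (mset_set (arcs \<Gamma> - insert a C))"
      using insert by (metis Diff_insert DiffI finite_Diff finite_arcs insert_subset mset_set.remove)
    then have "reachable ((\<Sum>v\<in>verts \<Gamma>. node v) + {#arrow a#} +
        (image_mset arrow (mset_set (arcs \<Gamma> - insert a C)) +
         image_mset (reversed_arrow {}) (mset_set C)))"
      using insert by (simp add: ac_simps)
    from reachable_reverse_arrow[OF _ _ _ this] insert show ?case
      by (simp add: ac_simps)
  qed
  from this[of "arcs \<Gamma>"] show ?thesis by simp
qed

end

section \<open>Negating the nodes\<close>

context toda_node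
begin

lemma attached_unique:
  assumes "attached p v" "attached p' v"
  shows "p = p'"
proof -
  have "p = 0 \<or> p = p'" "p' = 0 \<or> p' = p"
    using assms unfolding attached_def by (metis not_gr_zero zero_neq_one)+
  then show ?thesis by auto
qed

lemma the_attached: "attached p v \<Longrightarrow> (THE p. attached p v) = p"
  using attached_unique by blast

end

context loopfree_weighted_quiver
begin

definition negated_node :: "'v \<Rightarrow> ('v gen \<Rightarrow>\<^sub>0 int) multiset" where
  "negated_node v = image_mset (\<lambda>m. - s_vector v m) (mset_set {1..<d v}) +
     image_mset (\<lambda>m. - t_vector v m) (mset_set {1..<d v})"

lemma sum_sv_tv:
  assumes "v \<in> verts \<Gamma>"
  shows "(\<Sum>n\<in>{1..<d v}. s_vector v n + t_vector v n) = momentum v 1 - momentum v (d v)"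
proof -
  have "(\<Sum>n\<in>{1..<k}. s_vector v n + t_vector v n) = momentum v 1 - momentum v k" if "1 \<le> k" for k
    using that by (induction k rule: dec_induct) (simp_all add: s_vector_def t_vector_def)
  then show ?thesis using dim_pos[OF assms] by blast
qed

text \<open>
  A reversed arrow is attached at position \<open>1\<close> of its head, through \<open>- p\<^sub>1\<close>, and at
  position \<open>d - 1\<close> of its tail, through \<open>p\<^sub>d\<close>.
\<close>
lemma reachable_reverse_node_of_quiver:
  assumes v: "v \<in> verts \<Gamma>" "v \<notin> U" "U \<subseteq> verts \<Gamma>"
    and reach: "reachable ((\<Sum>w\<in>verts \<Gamma> - U. node w) + (\<Sum>w\<in>U. negated_node w) +
      image_mset (reversed_arrow U) (mset_set (arcs \<Gamma>)))"
  shows "reachable ((\<Sum>w\<in>verts \<Gamma> - insert v U. node w) + (\<Sum>w\<in>insert v U. negated_node w) +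
      image_mset (reversed_arrow (insert v U)) (mset_set (arcs \<Gamma>)))"
proof -
  interpret N: toda_node form labels seed "s_vector v" "t_vector v" "d v" by (rule toda[OF v(1)])
  let ?V = "verts \<Gamma> - insert v U"
  let ?nodes = "(\<Sum>w\<in>?V. node w) + (\<Sum>w\<in>U. negated_node w)"
  let ?R = "?nodes + image_mset (reversed_arrow U) (mset_set (arcs \<Gamma>))"
  let ?q = "\<lambda>w. THE p. N.attached p w"
  let ?total = "\<Sum>n\<in>{1..<d v}. s_vector v n + t_vector v n"
  have fin: "finite U" using v(3) finite_verts by (rule finite_subset)
  have nodes: "N.attached 0 w" if w: "w \<in># ?nodes" for w
  proof -
    have "(\<exists>x\<in>?V. w \<in># node x) \<or> (\<exists>x\<in>U. w \<in># negated_node x)"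
      using w fin by (simp add: set_mset_sum)
    then obtain x where "x \<noteq> v" "w \<in># node x \<or> w \<in># negated_node x"
      using v(2) by (metis DiffE insertCI)
    then show ?thesis using dim_pos[OF v(1)]
      by (auto simp: N.attached_def node_def negated_node_def s_vector_def t_vector_def form_eval)
  qed
  have arrows: "N.attached (if d v = 1 then 0 else if head \<Gamma> a = v then 1
      else if tail \<Gamma> a = v then d v - 1 else 0) (reversed_arrow U a)" if "a \<in> arcs \<Gamma>" for a
  proof (cases "d v = 1")
    case True
    then show ?thesis unfolding N.attached_def by auto
  next
    case False
    then have gauge_index: "gauge_index v n \<longleftrightarrow> 1 \<le> n \<and> n \<le> d v" for n
      using v(1) flavor_dim[of v] by (auto simp: gauge_index_def)
    show ?thesis
      unfolding N.attached_def using no_loop[OF that] dim_pos[OF v(1)] v(2) False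
      by (auto simp: reversed_arrow_def s_vector_def t_vector_def form_eval gauge_index)
  qed
  have V: "verts \<Gamma> - U = insert v ?V" using v by auto
  have "(\<Sum>w\<in>verts \<Gamma> - U. node w) = node v + (\<Sum>w\<in>?V. node w)"
    unfolding V by (rule sum.insert) auto
  then have "reachable (image_mset (s_vector v) (mset_set {1..<d v}) +
      image_mset (t_vector v) (mset_set {1..<d v}) + ?R)"
    using reach by (simp add: node_def ac_simps)
  then have "reachable (image_mset (\<lambda>n. - s_vector v n) (mset_set {1..<d v}) +
      image_mset (\<lambda>n. - t_vector v n) (mset_set {1..<d v}) +
      image_mset (\<lambda>w. if ?q w = 0 then w else w + ?total) ?R)"
  proof (rule N.reachable_reverse_node)
    fix w assume "w \<in># ?R"
    then consider "w \<in># ?nodes" | a where "a \<in> arcs \<Gamma>" "w = reversed_arrow U a" by auto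
    then show "N.attached (?q w) w \<and> ?q w \<in> {0, 1, d v - 1}"
    proof cases
      case 1
      from nodes[OF this] show ?thesis by (simp add: N.the_attached)
    next
      case 2
      from arrows[OF 2(1)] show ?thesis unfolding 2(2) by (simp add: N.the_attached)
    qed
  qed
  then have "reachable (negated_node v +
      image_mset (\<lambda>w. if ?q w = 0 then w else w + ?total) ?R)"
    by (simp only: negated_node_def[of v])
  moreover have "image_mset (\<lambda>w. if ?q w = 0 then w else w + ?total) ?nodes = ?nodes"
    by (rule multiset.map_ident_strong) (use nodes in \<open>simp add: N.the_attached\<close>)
  moreover have "image_mset (\<lambda>w. if ?q w = 0 then w else w + ?total)
      (image_mset (reversed_arrow U) (mset_set (arcs \<Gamma>))) =
      image_mset (reversed_arrow (insert v U)) (mset_set (arcs \<Gamma>))"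
    unfolding multiset.map_comp comp_def
  proof (rule image_mset_cong)
    fix a assume "a \<in># mset_set (arcs \<Gamma>)"
    then have a: "a \<in> arcs \<Gamma>" by simp
    show "(if ?q (reversed_arrow U a) = 0 then reversed_arrow U a else reversed_arrow U a + ?total) =
        reversed_arrow (insert v U) a"
      unfolding N.the_attached[OF arrows[OF a]] sum_sv_tv[OF v(1)]
      using no_loop[OF a] v(2) dim_pos[OF v(1)] by (auto simp: reversed_arrow_def)
  qed
  ultimately show ?thesis using v(2) fin by (simp add: ac_simps)
qed

theorem admits_cluster_DT: "admits_cluster_DT form labels seed"
proof -
  have "reachable ((\<Sum>w\<in>verts \<Gamma> - U. node w) + (\<Sum>w\<in>U. negated_node w) +
      image_mset (reversed_arrow U) (mset_set (arcs \<Gamma>)))" if "U \<subseteq> verts \<Gamma>" for U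
    using finite_subset[OF that finite_verts] that
  proof (induction U rule: finite_induct)
    case empty
    then show ?case using reachable_reverse_arrows by simp
  next
    case (insert v U)
    then show ?case by (intro reachable_reverse_node_of_quiver) auto
  qed
  from this[of "verts \<Gamma>"]
  have "reachable ((\<Sum>w\<in>verts \<Gamma>. negated_node w) +
      image_mset (reversed_arrow (verts \<Gamma>)) (mset_set (arcs \<Gamma>)))"
    by simp
  moreover have "image_mset (\<lambda>m. - seed (S v m)) (mset_set {1..<d v}) +
      image_mset (\<lambda>m. - seed (T v m)) (mset_set {1..<d v}) = negated_node v" for v
    using flavor_dim seed_S seed_T
    by (cases "v \<in> F") (simp_all add: negated_node_def del: seed_vector.simps)
  moreover have "image_mset (\<lambda>a. - seed (Arrow a)) (mset_set (arcs \<Gamma>)) =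
      image_mset (reversed_arrow (verts \<Gamma>)) (mset_set (arcs \<Gamma>))"
    by (rule image_mset_cong)
      (use seed_Arrow in \<open>auto simp: reversed_arrow_def simp del: seed_vector.simps\<close>)
  ultimately have "reachable (image_mset (\<lambda>l. - seed l) (mset_set labels))"
    unfolding seed_mset by simp
  then show ?thesis by (rule reachable_imp_admits_cluster_DT)
qed

end

section \<open>Cluster seeds from dual functionals\<close>

interpretation frag: module frag_cmul
  by (rule module_frag_cmul)

text \<open>
  Over the integers linear independence is checked by a functional that vanishes on \<open>V\<close>:
  that \<open>x\<close> lies outside the span, which suffices over a field, would not be enough.
\<close>
lemma independent_insert_functional:
  fixes \<phi> :: "('b \<Rightarrow>\<^sub>0 int) \<Rightarrow> int"
  assumes ind: "frag.independent V"
    and add: "\<And>u v. \<phi> (u + v) = \<phi> u + \<phi> v"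
    and x: "\<phi> x \<noteq> 0" and V: "\<And>v. v \<in> V \<Longrightarrow> \<phi> v = 0"
  shows "frag.independent (insert x V)"
proof
  assume "frag.dependent (insert x V)"
  then obtain t c v where t: "finite t" "t \<subseteq> insert x V" "(\<Sum>v\<in>t. frag_cmul (c v) v) = 0"
      "v \<in> t" "c v \<noteq> 0"
    unfolding frag.dependent_explicit by blast
  have \<phi>: "(\<Sum>v\<in>t. c v * \<phi> v) = 0"
    using additive_sum[where \<phi> = \<phi> and I = t and f = "\<lambda>v. frag_cmul (c v) v", OF add] t(3) add[of 0 0]
    by (simp add: additive_frag_cmul[where \<phi> = \<phi>, OF add])
  have "(\<Sum>v\<in>t. c v * \<phi> v) = (\<Sum>v\<in>t. if v = x then c x * \<phi> x else 0)"
    by (rule sum.cong) (use t(2) V in auto)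
  then have cx: "x \<in> t \<Longrightarrow> c x = 0" using \<phi> t(1) x by simp
  have "(\<Sum>v\<in>t - {x}. frag_cmul (c v) v) = 0"
    using t(1,3) cx by (cases "x \<in> t") (simp_all add: sum.remove)
  moreover have "v \<in> t - {x}" using t(4,5) cx by auto
  moreover have "finite (t - {x})" "t - {x} \<subseteq> V" using t(1,2) by auto
  ultimately have "frag.dependent V"
    unfolding frag.dependent_explicit using t(5) by blast
  then show False using ind by simp
qed

text \<open>
  The values of a coordinate on the subgroup form an ideal; an element attaining its generator,
  together with a basis of the kernel of that coordinate, is a basis.
\<close>
lemma subgroup_has_basis:
  fixes H :: "('b \<Rightarrow>\<^sub>0 int) set"
  assumes "finite G" "frag.subspace H" "\<And>u. u \<in> H \<Longrightarrow> Poly_Mapping.keys u \<subseteq> G"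
  shows "\<exists>V. frag.independent V \<and> frag.span V = H"
  using assms
proof (induction G arbitrary: H rule: finite_induct)
  case empty
  then have "H = {0}" using frag.subspace_0[OF empty.prems(1)] by auto
  then show ?case using frag.independent_empty frag.span_empty by blast
next
  case (insert x G)
  let ?\<phi> = "\<lambda>u. Poly_Mapping.lookup u x"
  define H\<^sub>0 where "H\<^sub>0 = {u \<in> H. ?\<phi> u = 0}"
  note H = frag.subspace_0[OF insert.prems(1)] frag.subspace_add[OF insert.prems(1)]
    frag.subspace_diff[OF insert.prems(1)] frag.subspace_scale[OF insert.prems(1)]
  have "frag.subspace H\<^sub>0"
    unfolding H\<^sub>0_def by (rule frag.subspaceI) (auto simp: H lookup_add)
  moreover have "Poly_Mapping.keys u \<subseteq> G" if "u \<in> H\<^sub>0" for u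
    using that insert.prems(2)[of u] by (auto simp: H\<^sub>0_def in_keys_iff)
  ultimately obtain V where V: "frag.independent V" "frag.span V = H\<^sub>0"
    using insert.IH by blast
  show ?case
  proof (cases "\<exists>u\<in>H. ?\<phi> u \<noteq> 0")
    case False
    then have "H\<^sub>0 = H" by (auto simp: H\<^sub>0_def)
    then show ?thesis using V by blast
  next
    case True
    let ?Q = "\<lambda>n. \<exists>u\<in>H. ?\<phi> u = int n \<and> 0 < n"
    have "\<exists>n. ?Q n"
    proof -
      obtain u where u: "u \<in> H" "?\<phi> u \<noteq> 0" using True by blast
      have "- u \<in> H" using H(3)[OF H(1) u(1)] by simp
      then have "?Q (nat \<bar>?\<phi> u\<bar>)"
        using u by (cases "?\<phi> u > 0") (force intro: bexI[of _ u] bexI[of _ "- u"])+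
      then show ?thesis by blast
    qed
    then have "?Q (LEAST n. ?Q n)" by (rule LeastI_ex)
    then obtain h where h: "h \<in> H" "0 < ?\<phi> h" "?\<phi> h = int (LEAST n. ?Q n)" by auto
    have split: "u - frag_cmul (?\<phi> u div ?\<phi> h) h \<in> H\<^sub>0" if u: "u \<in> H" for u
    proof -
      let ?w = "u - frag_cmul (?\<phi> u div ?\<phi> h) h"
      have w: "?w \<in> H" using H h(1) u by blast
      have mod: "?\<phi> ?w = ?\<phi> u mod ?\<phi> h"
        by (simp add: lookup_minus minus_mult_div_eq_mod mult.commute)
      have "?\<phi> ?w = 0"
      proof (rule ccontr)
        assume "?\<phi> ?w \<noteq> 0"
        then have "0 < ?\<phi> ?w" "?\<phi> ?w < ?\<phi> h"
          using pos_mod_bound[OF h(2), of "?\<phi> u"] pos_mod_sign[OF h(2), of "?\<phi> u"]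
          unfolding mod by linarith+
        then have "?Q (nat (?\<phi> ?w))" "nat (?\<phi> ?w) < (LEAST n. ?Q n)"
          using w h(3) by (auto intro!: bexI[of _ ?w])
        then show False using not_less_Least by blast
      qed
      then show ?thesis using w by (simp add: H\<^sub>0_def)
    qed
    have "frag.independent (insert h V)"
    proof (rule independent_insert_functional[OF V(1), of ?\<phi>])
      show "?\<phi> v = 0" if "v \<in> V" for v
        using frag.span_base[OF that] V(2) by (simp add: H\<^sub>0_def)
    qed (use h(2) in \<open>simp_all add: lookup_add\<close>)
    moreover have "frag.span (insert h V) = H"
    proof
      have "V \<subseteq> H" using frag.span_superset[of V] V(2) by (auto simp: H\<^sub>0_def)
      then show "frag.span (insert h V) \<subseteq> H"
        using h(1) by (intro frag.span_minimal insert.prems(1)) simp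
      show "H \<subseteq> frag.span (insert h V)"
      proof
        fix u assume "u \<in> H"
        from split[OF this] have "u - frag_cmul (?\<phi> u div ?\<phi> h) h \<in> frag.span V" by (simp add: V(2))
        then show "u \<in> frag.span (insert h V)"
          unfolding frag.span_insert by blast
      qed
    qed
    ultimately show ?thesis by blast
  qed
qed

lemma subspace_keys_subset: "frag.subspace {u :: 'b \<Rightarrow>\<^sub>0 int. Poly_Mapping.keys u \<subseteq> G}"
proof (rule frag.subspaceI)
  fix u v :: "'b \<Rightarrow>\<^sub>0 int" and c
  assume u: "u \<in> {u. Poly_Mapping.keys u \<subseteq> G}"
  show "frag_cmul c u \<in> {u. Poly_Mapping.keys u \<subseteq> G}" using u keys_cmul[of c u] by blast
  assume "v \<in> {u. Poly_Mapping.keys u \<subseteq> G}"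
  then show "u + v \<in> {u. Poly_Mapping.keys u \<subseteq> G}" using u Poly_Mapping.keys_add[of u v] by blast
qed simp

text \<open>
  Dual functionals split the lattice into the span of the vectors and the common kernel of the
  functionals, which is a subgroup of a free abelian group of finite rank and hence has a basis.
\<close>
lemma cluster_seed_if_dual_functionals:
  fixes e :: "'k \<Rightarrow> 'b \<Rightarrow>\<^sub>0 int" and \<phi> :: "'k \<Rightarrow> ('b \<Rightarrow>\<^sub>0 int) \<Rightarrow> int"
  assumes "finite K" "finite G"
    and e: "\<And>k. k \<in> K \<Longrightarrow> Poly_Mapping.keys (e k) \<subseteq> G"
    and add: "\<And>k u v. \<phi> k (u + v) = \<phi> k u + \<phi> k v"
    and dual: "\<And>k l. k \<in> K \<Longrightarrow> l \<in> K \<Longrightarrow> \<phi> k (e l) = (if k = l then 1 else 0)"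
  shows "cluster_seed {u. Poly_Mapping.keys u \<subseteq> G} K e"
proof -
  let ?L = "{u. Poly_Mapping.keys u \<subseteq> G}"
  define H where "H = {u \<in> ?L. \<forall>k\<in>K. \<phi> k u = 0}"
  note L = subspace_keys_subset[of G]
  note cmul = additive_frag_cmul[where \<phi> = "\<phi> k" for k, OF add]
  have zero: "\<phi> k 0 = 0" for k using add[of k 0 0] by simp
  have "frag.subspace {u. \<forall>k\<in>K. \<phi> k u = 0}"
    by (rule frag.subspaceI) (auto simp: add cmul zero)
  then have "frag.subspace (?L \<inter> {u. \<forall>k\<in>K. \<phi> k u = 0})"
    by (rule frag.subspace_inter[OF L])
  moreover have "?L \<inter> {u. \<forall>k\<in>K. \<phi> k u = 0} = H" by (auto simp: H_def)
  ultimately have "frag.subspace H" by simp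
  then have "\<exists>V. frag.independent V \<and> frag.span V = H"
    by (rule subgroup_has_basis[OF assms(2)]) (simp add: H_def)
  then obtain V where V: "frag.independent V" "frag.span V = H" by blast
  have VH: "V \<subseteq> H" using frag.span_superset[of V] V(2) by simp
  have "frag.independent (e ` J \<union> V)" if "J \<subseteq> K" for J
    using finite_subset[OF that assms(1)] that
  proof (induction J rule: finite_induct)
    case (insert k J)
    then have "frag.independent (insert (e k) (e ` J \<union> V))"
      using dual VH by (intro independent_insert_functional[of _ "\<phi> k"] add) (auto simp: H_def)
    then show ?case by simp
  qed (simp add: V(1))
  then have ind: "frag.independent (e ` K \<union> V)" by simp
  have "frag.span (e ` K \<union> V) = ?L"
  proof
    show "frag.span (e ` K \<union> V) \<subseteq> ?L"
      using e VH by (intro frag.span_minimal L) (auto simp: H_def)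
    show "?L \<subseteq> frag.span (e ` K \<union> V)"
    proof
      fix u :: "'b \<Rightarrow>\<^sub>0 int"
      assume u: "u \<in> ?L"
      let ?w = "\<Sum>k\<in>K. frag_cmul (\<phi> k u) (e k)"
      have w: "?w \<in> frag.span (e ` K \<union> V)"
        by (intro frag.span_sum frag.span_scale frag.span_base) auto
      have "?w \<in> ?L" by (intro frag.subspace_sum[OF L] frag.subspace_scale[OF L]) (use e in auto)
      then have "u - ?w \<in> ?L" using frag.subspace_diff[OF L u] by blast
      moreover have "\<phi> l (u - ?w) = 0" if "l \<in> K" for l
      proof -
        have "\<phi> l ?w = (\<Sum>k\<in>K. \<phi> k u * \<phi> l (e k))"
          by (simp add: additive_sum[where \<phi> = "\<phi> l", OF add] cmul)
        also have "\<dots> = (\<Sum>k\<in>K. if k = l then \<phi> k u else 0)"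
          using that by (intro sum.cong) (auto simp: dual)
        also have "\<dots> = \<phi> l u" using that assms(1) by simp
        finally show ?thesis using add[of l "u - ?w" ?w] by simp
      qed
      ultimately have "u - ?w \<in> frag.span V" by (simp add: V(2) H_def)
      then have "u - ?w \<in> frag.span (e ` K \<union> V)" using frag.span_mono[of V "e ` K \<union> V"] by blast
      from frag.span_add[OF this w] show "u \<in> frag.span (e ` K \<union> V)" by simp
    qed
  qed
  moreover have "inj_on e K"
  proof (rule inj_onI)
    fix k l assume "k \<in> K" "l \<in> K" "e k = e l"
    then have "(if k = l then 1 else 0) = (1::int)" using dual[of k l] dual[of k k] by simp
    then show "k = l" by (simp split: if_splits)
  qed
  ultimately show ?thesis
    unfolding cluster_seed_def Z_basis_def using assms(1) ind by blast
qed

definition functional :: "'b set \<Rightarrow> ('b \<Rightarrow> int) \<Rightarrow> ('b \<Rightarrow>\<^sub>0 int) \<Rightarrow> int" where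
  "functional G c u = (\<Sum>x\<in>G. Poly_Mapping.lookup u x * c x)"

lemma functional_add: "functional G c (u + v) = functional G c u + functional G c v"
  by (simp add: functional_def lookup_add algebra_simps sum.distrib)

lemma functional_diff: "functional G c (u - v) = functional G c u - functional G c v"
  by (simp add: functional_def lookup_minus algebra_simps sum_subtractf)

lemma functional_frag_of: "finite G \<Longrightarrow> functional G c (frag_of x) = (if x \<in> G then c x else 0)"
  by (simp add: functional_def if_distrib[of "\<lambda>a. a * _"] cong: if_cong)

section \<open>The Donaldson-Thomas transformation of a quiver\<close>

context loopfree_weighted_quiver
begin

abbreviation generators :: "'v gen set" where
  "generators \<equiv> gens \<Gamma> F d g"

lemma finite_generators: "finite generators"
proof -
  have "generators \<subseteq> (\<lambda>(i, m). P i m) ` Sigma (verts \<Gamma>) (\<lambda>i. {1..d i}) \<union>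
      (\<lambda>(i, m). X i m) ` Sigma (verts \<Gamma>) (\<lambda>i. {1..d i}) \<union> Zeta ` verts \<Gamma> \<union> Upsilon ` {1..g}"
    using flavor_subset by (auto simp: gens_def image_iff)
  then show ?thesis by (rule finite_subset) auto
qed

lemma functional_gens:
  "functional generators c (frag_of (P i m)) = (if gauge_index i m then c (P i m) else 0)"
  "functional generators c (frag_of (X i m)) = (if gauge_index i m then c (X i m) else 0)"
  "functional generators c (frag_of (Zeta i)) = (if i \<in> F then c (Zeta i) else 0)"
  "functional generators c (frag_of (Upsilon r)) = (if r \<in> {1..g} then c (Upsilon r) else 0)"
proof -
  have "P i m \<in> generators \<longleftrightarrow> gauge_index i m" "X i m \<in> generators \<longleftrightarrow> gauge_index i m"
    "Zeta i \<in> generators \<longleftrightarrow> i \<in> F" "Upsilon r \<in> generators \<longleftrightarrow> r \<in> {1..g}"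
    by (auto simp: gens_def gauge_index_def)
  then show
    "functional generators c (frag_of (P i m)) = (if gauge_index i m then c (P i m) else 0)"
    "functional generators c (frag_of (X i m)) = (if gauge_index i m then c (X i m) else 0)"
    "functional generators c (frag_of (Zeta i)) = (if i \<in> F then c (Zeta i) else 0)"
    "functional generators c (frag_of (Upsilon r)) = (if r \<in> {1..g} then c (Upsilon r) else 0)"
    by (simp_all only: functional_frag_of[OF finite_generators])
qed

lemma functional_cyc:
  "functional generators c (cycle_part a) = (if tail \<Gamma> a \<in> F \<or> head \<Gamma> a \<in> F then 0
     else \<Sum>r=1..g. \<theta> r a * c (Upsilon r))"
proof -
  note add = functional_add[of generators c]
  have "functional generators c (\<Sum>r=1..g. frag_cmul (\<theta> r a) (frag_of (Upsilon r))) =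
      (\<Sum>r=1..g. \<theta> r a * functional generators c (frag_of (Upsilon r)))"
    by (simp only: additive_sum[where \<phi> = "functional generators c", OF add]
        additive_frag_cmul[where \<phi> = "functional generators c", OF add])
  also have "\<dots> = (\<Sum>r=1..g. \<theta> r a * c (Upsilon r))"
    by (intro sum.cong) (auto simp: functional_gens)
  finally show ?thesis
    using additive_frag_cmul[where \<phi> = "functional generators c" and c = 0, OF add]
    by (simp add: cycle_part_def)
qed

lemma functional_seed:
  shows "S i m \<in> labels \<Longrightarrow> functional generators c (seed (S i m)) = c (X i (m + 1)) - c (X i m)"
    and "T i m \<in> labels \<Longrightarrow> functional generators c (seed (T i m)) =
      c (P i m) - c (P i (m + 1)) + c (X i m) - c (X i (m + 1))"
    and "a \<in> arcs \<Gamma> \<Longrightarrow> functional generators c (seed (Arrow a)) =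
      (if head \<Gamma> a \<in> F then c (Zeta (head \<Gamma> a)) else c (P (head \<Gamma> a) (d (head \<Gamma> a)))) -
      (if tail \<Gamma> a \<in> F then c (Zeta (tail \<Gamma> a)) else c (P (tail \<Gamma> a) 1)) +
      (if tail \<Gamma> a \<in> F \<or> head \<Gamma> a \<in> F then 0 else \<Sum>r=1..g. \<theta> r a * c (Upsilon r))"
proof -
  show "functional generators c (seed (S i m)) = c (X i (m + 1)) - c (X i m)" if "S i m \<in> labels"
    using that by (auto simp: functional_diff functional_gens gauge_index_def seed_labels_def)
  show "functional generators c (seed (T i m)) =
      c (P i m) - c (P i (m + 1)) + c (X i m) - c (X i (m + 1))" if "T i m \<in> labels"
    using that by (auto simp: functional_diff functional_add functional_gens gauge_index_def seed_labels_def)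
  assume a: "a \<in> arcs \<Gamma>"
  have ends: "functional generators c (momentum v m) = (if v \<in> F then c (Zeta v) else c (P v m))"
    if "v \<in> verts \<Gamma>" "m = 1 \<or> m = d v" for v m
    using that dim_pos[OF that(1)] by (auto simp: momentum_def functional_gens gauge_index_def)
  have "head \<Gamma> a \<in> verts \<Gamma>" "tail \<Gamma> a \<in> verts \<Gamma>" using a by auto
  then show "functional generators c (seed (Arrow a)) =
      (if head \<Gamma> a \<in> F then c (Zeta (head \<Gamma> a)) else c (P (head \<Gamma> a) (d (head \<Gamma> a)))) -
      (if tail \<Gamma> a \<in> F then c (Zeta (tail \<Gamma> a)) else c (P (tail \<Gamma> a) 1)) +
      (if tail \<Gamma> a \<in> F \<or> head \<Gamma> a \<in> F then 0 else \<Sum>r=1..g. \<theta> r a * c (Upsilon r))"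
    unfolding seed_Arrow[OF a] functional_add functional_diff functional_cyc
    by (simp only: ends simp_thms)
qed

theorem cluster_seed:
  assumes basis: "H1_basis \<Gamma> g \<theta>"
    and flavor: "\<And>r a. r \<in> {1..g} \<Longrightarrow> a \<in> arcs \<Gamma> \<Longrightarrow> tail \<Gamma> a \<in> F \<or> head \<Gamma> a \<in> F \<Longrightarrow> \<theta> r a = 0"
  shows "cluster_seed (quiver_lattice \<Gamma> F d g) labels seed"
proof -
  have "\<exists>n. cohomologous \<Gamma> c (\<lambda>b. \<Sum>r=1..g. n r * \<theta> r b)" for c
    using basis unfolding H1_basis_def by (elim conjE allE)
  from this[of "\<lambda>b. if b = a then 1 else 0" for a]
  have "\<exists>n f. \<forall>b\<in>arcs \<Gamma>. (if b = a then 1 else 0) - (\<Sum>r=1..g. n r * \<theta> r b) =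
      f (head \<Gamma> b) - f (tail \<Gamma> b)" for a
    unfolding cohomologous_def .
  then obtain n f where nf: "\<And>a b. b \<in> arcs \<Gamma> \<Longrightarrow>
      (if b = a then 1 else 0) - (\<Sum>r=1..g. n a r * \<theta> r b) =
      (f a (head \<Gamma> b) - f a (tail \<Gamma> b) :: int)"
    by metis
  \<comment> \<open>A 0-cochain plus a combination of the \<open>\<theta>\<close> that represents the indicator of \<open>a\<close>.\<close>
  define cA where "cA a x = (case x of P v m \<Rightarrow> f a v | X v m \<Rightarrow> 0 | Zeta v \<Rightarrow> f a v
    | Upsilon r \<Rightarrow> n a r)" for a and x :: "'v gen"
  \<comment> \<open>The partial sums of momentum coefficients are dual to the \<open>t\<close>, but they also see the
    arrows leaving \<open>i\<close>; the functionals of those arrows correct this.\<close>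
  define cT where "cT i m x = (case x of P v k \<Rightarrow> if v = i \<and> k \<le> m then 1 else 0 | _ \<Rightarrow> (0 :: int))"
    for i :: 'v and m :: nat and x :: "'v gen"
  \<comment> \<open>Likewise for the coordinates, which see \<open>t\<close> with the sign opposite to that of \<open>s\<close>.\<close>
  define cS where "cS i m x = (case x of X v k \<Rightarrow> if v = i \<and> k \<le> m then - 1 else 0 | _ \<Rightarrow> (0 :: int))"
    for i :: 'v and m :: nat and x :: "'v gen"
  let ?ext = "functional generators"
  define \<phi>A where "\<phi>A a u = ?ext (cA a) u" for a u
  define \<phi>T where "\<phi>T i m u = ?ext (cT i m) u + (\<Sum>a\<in>arcs \<Gamma>. if tail \<Gamma> a = i then \<phi>A a u else 0)"
    for i m u
  define \<phi>S where "\<phi>S i m u = ?ext (cS i m) u + \<phi>T i m u" for i m u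
  define \<phi> where "\<phi> l = (case l of S i m \<Rightarrow> \<phi>S i m | T i m \<Rightarrow> \<phi>T i m | Arrow a \<Rightarrow> \<phi>A a)" for l
  have addA: "\<phi>A a (u + v) = \<phi>A a u + \<phi>A a v" for a u v by (simp add: \<phi>A_def functional_add)
  have addT: "\<phi>T i m (u + v) = \<phi>T i m u + \<phi>T i m v" for i m u v
  proof -
    have "(\<Sum>a\<in>arcs \<Gamma>. if tail \<Gamma> a = i then \<phi>A a (u + v) else 0) =
        (\<Sum>a\<in>arcs \<Gamma>. (if tail \<Gamma> a = i then \<phi>A a u else 0) + (if tail \<Gamma> a = i then \<phi>A a v else 0))"
      by (intro sum.cong) (auto simp: addA)
    then show ?thesis by (simp add: \<phi>T_def functional_add sum.distrib)
  qed
  have add: "\<phi> l (u + v) = \<phi> l u + \<phi> l v" for l u v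
    by (cases l) (simp_all add: \<phi>_def addA addT \<phi>S_def functional_add)
  have A_S: "\<phi>A a (seed (S j k)) = 0" if "S j k \<in> labels" for a j k
    unfolding \<phi>A_def functional_seed(1)[OF that] by (simp add: cA_def)
  have A_T: "\<phi>A a (seed (T j k)) = 0" if "T j k \<in> labels" for a j k
    unfolding \<phi>A_def functional_seed(2)[OF that] by (simp add: cA_def)
  have A_A: "\<phi>A a (seed (Arrow b)) = (if a = b then 1 else 0)" if b: "b \<in> arcs \<Gamma>" for a b
  proof -
    have "(\<Sum>r=1..g. \<theta> r b * n a r) = 0" if "tail \<Gamma> b \<in> F \<or> head \<Gamma> b \<in> F"
      using flavor[OF _ b that] by simp
    then show ?thesis
      using nf[OF b, of a] unfolding \<phi>A_def functional_seed(3)[OF b]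
      by (auto simp: cA_def mult.commute)
  qed
  have T_S: "\<phi>T i m (seed (S j k)) = 0" if "S j k \<in> labels" for i m j k
    unfolding \<phi>T_def functional_seed(1)[OF that] A_S[OF that] by (simp add: cT_def)
  have T_T: "\<phi>T i m (seed (T j k)) = (if i = j \<and> m = k then 1 else 0)" if "T j k \<in> labels" for i m j k
    unfolding \<phi>T_def functional_seed(2)[OF that] A_T[OF that] by (simp add: cT_def) 
  have T_A: "\<phi>T i m (seed (Arrow b)) = 0" if b: "b \<in> arcs \<Gamma>" and im: "T i m \<in> labels" for i m b
  proof -
    have "(\<Sum>a\<in>arcs \<Gamma>. if tail \<Gamma> a = i then \<phi>A a (seed (Arrow b)) else 0) =
        (\<Sum>a\<in>arcs \<Gamma>. if a = b then (if tail \<Gamma> b = i then 1 else 0) else 0)"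
      by (intro sum.cong) (auto simp: A_A[OF b] simp del: seed_vector.simps)
    then have "(\<Sum>a\<in>arcs \<Gamma>. if tail \<Gamma> a = i then \<phi>A a (seed (Arrow b)) else 0) =
        (if tail \<Gamma> b = i then 1 else 0)"
      using b by (simp del: seed_vector.simps)
    moreover have "?ext (cT i m) (seed (Arrow b)) = - (if tail \<Gamma> b = i then 1 else 0)"
      unfolding functional_seed(3)[OF b] using im by (auto simp: cT_def seed_labels_def)
    ultimately show ?thesis by (simp add: \<phi>T_def del: seed_vector.simps)
  qed
  have S_S: "\<phi>S i m (seed (S j k)) = (if i = j \<and> m = k then 1 else 0)" if "S j k \<in> labels" for i m j k
    unfolding \<phi>S_def functional_seed(1)[OF that] T_S[OF that] by (simp add: cS_def)
  have S_T: "\<phi>S i m (seed (T j k)) = 0" if "T j k \<in> labels" for i m j k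
    unfolding \<phi>S_def functional_seed(2)[OF that] T_T[OF that] by (simp add: cS_def)
  have S_A: "\<phi>S i m (seed (Arrow b)) = 0" if b: "b \<in> arcs \<Gamma>" and im: "S i m \<in> labels" for i m b
  proof -
    have "T i m \<in> labels" using im by (auto simp: seed_labels_def)
    from T_A[OF b this] show ?thesis
      unfolding \<phi>S_def functional_seed(3)[OF b] by (simp add: cS_def)
  qed
  have dual: "\<phi> k (seed l) = (if k = l then 1 else 0)" if "k \<in> labels" "l \<in> labels" for k l
  proof (cases l)
    case (S j m)
    then show ?thesis using that A_S[of j m] T_S[of j m] S_S[of j m]
      by (cases k) (auto simp: \<phi>_def simp del: seed_vector.simps)
  next
    case (T j m)
    then show ?thesis using that A_T[of j m] T_T[of j m] S_T[of j m]
      by (cases k) (auto simp: \<phi>_def simp del: seed_vector.simps)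
  next
    case (Arrow b)
    then have "b \<in> arcs \<Gamma>" using that(2) by (auto simp: seed_labels_def)
    then show ?thesis using Arrow that A_A[of b] T_A[of b] S_A[of b]
      by (cases k) (auto simp: \<phi>_def simp del: seed_vector.simps)
  qed
  have keys: "Poly_Mapping.keys (seed l) \<subseteq> generators" if "l \<in> labels" for l
  proof -
    let ?L = "{u. Poly_Mapping.keys u \<subseteq> generators}"
    note L = subspace_keys_subset[of generators]
    note closed = frag.subspace_add[OF L] frag.subspace_diff[OF L] frag.subspace_sum[OF L]
      frag.subspace_scale[OF L] frag.subspace_0[OF L]
    have P: "frag_of (P i m) \<in> ?L" and X: "frag_of (X i m) \<in> ?L" if "gauge_index i m" for i m
      using that by (auto simp: gens_def gauge_index_def)
    have Zeta: "frag_of (Zeta i) \<in> ?L" if "i \<in> F" for i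
      using that by (auto simp: gens_def)
    have Upsilon: "frag_of (Upsilon r) \<in> ?L" if "r \<in> {1..g}" for r
      using that by (auto simp: gens_def)
    have "seed l \<in> ?L"
    proof (cases l)
      case (S j m)
      then have "gauge_index j m" "gauge_index j (m + 1)" using that by (auto simp: seed_labels_def gauge_index_def)
      then show ?thesis unfolding S seed_vector.simps by (intro closed X)
    next
      case (T j m)
      then have "gauge_index j m" "gauge_index j (m + 1)" using that by (auto simp: seed_labels_def gauge_index_def)
      then show ?thesis unfolding T seed_vector.simps by (intro closed P X)
    next
      case (Arrow b)
      then have b: "b \<in> arcs \<Gamma>" using that by (auto simp: seed_labels_def)
      then have v: "head \<Gamma> b \<in> verts \<Gamma>" "tail \<Gamma> b \<in> verts \<Gamma>" by auto
      have momentum: "momentum v m \<in> ?L" if "v \<in> verts \<Gamma>" "m = 1 \<or> m = d v" for v m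
        unfolding momentum_def using that dim_pos[OF that(1)] P[of v m] Zeta[of v]
        by (auto simp: gauge_index_def)
      have "cycle_part b \<in> ?L"
      proof -
        have "(\<Sum>r=1..g. frag_cmul (\<theta> r b) (frag_of (Upsilon r))) \<in> ?L"
          by (intro closed Upsilon)
        then show ?thesis using closed(5) by (simp only: cycle_part_def split: if_split) simp
      qed
      then show ?thesis
        unfolding Arrow seed_Arrow[OF b] using v
        by (intro closed momentum) simp_all
    qed
    then show ?thesis by simp
  qed
  show ?thesis
    unfolding quiver_lattice_def
    by (rule cluster_seed_if_dual_functionals[OF finite_seed_labels finite_generators keys add dual])
qed

end

theorem mainTheorem2:
  fixes \<Gamma> :: "('v, 'a) pre_digraph" and F :: "'v set" and d :: "'v \<Rightarrow> nat"
    and g :: nat and \<theta> :: "nat \<Rightarrow> 'a \<Rightarrow> int"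
  assumes "weighted_quiver \<Gamma> F d"
    and "H1_basis \<Gamma> g \<theta>"
    and "\<forall>r\<in>{1..g}. \<forall>a\<in>arcs \<Gamma>. tail \<Gamma> a \<in> F \<or> head \<Gamma> a \<in> F \<longrightarrow> \<theta> r a = 0"
    and "loopfree_digraph \<Gamma>"
  shows "cluster_seed (quiver_lattice \<Gamma> F d g) (seed_labels \<Gamma> F d) (seed_vector \<Gamma> F d g \<theta>) \<and>
         admits_cluster_DT (quiver_form \<Gamma> F d) (seed_labels \<Gamma> F d) (seed_vector \<Gamma> F d g \<theta>)"
proof -
  have "loopfree_weighted_quiver \<Gamma> F d"
    using assms(1) loopfree_digraph.no_loops[OF assms(4)]
    by (simp add: loopfree_weighted_quiver_def loopfree_weighted_quiver_axioms_def)
  then interpret loopfree_weighted_quiver \<Gamma> F d g \<theta> .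
  show ?thesis
    using cluster_seed[OF assms(2)] assms(3) admits_cluster_DT by blast
qed

end
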